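(* Let $\mathbf{X}_\tau=(X_{\tau,1},\ldots,X_{\tau,k})'$, $\tau=0,\ldots,T$, be a sequence of independently distributed random return vectors of $k$ risky assets, and let $E(\mathbf{X}_\tau)=\boldsymbol{\mu}_\tau$ and $\mathrm{Var}(\mathbf{X}_\tau)=\boldsymbol{\Sigma}_\tau$, where $\boldsymbol{\Sigma}_\tau$ is positive definite. Consider the multi-period portfolio choice problem without riskless asset $$\max_{\{\mathbf{w}_s:\ \mathbf{w}_s'\mathbf{1}=1\}_{s=0}^{T-1}}E_0\Big[W_T-\frac{\alpha}{2}W_T^2\Big],\qquad W_t=W_{t-1}(1+\mathbf{w}_{t-1}'\mathbf{X}_t).$$ Then for all $t=1,\ldots,T$ the optimal multi-period portfolio weights for the period $T-t$ are given by $$\mathbf{w}^*_{T-t}=\frac{\boldsymbol{\Sigma}^{-1}_{T-t+1}\mathbf{1}}{\mathbf{1}'\boldsymbol{\Sigma}^{-1}_{T-t+1}\mathbf{1}}+\alpha_{T-t+1}^{-1}\mathbf{Q}_{T-t+1}\boldsymbol{\mu}_{T-t+1},$$ with $$\mathbf{Q}_{T-t+1}=\boldsymbol{\Sigma}^{-1}_{T-t+1}-\frac{\boldsymbol{\Sigma}^{-1}_{T-t+1}\mathbf{1}\mathbf{1}'\boldsymbol{\Sigma}^{-1}_{T-t+1}}{\mathbf{1}'\boldsymbol{\Sigma}^{-1}_{T-t+1}\mathbf{1}}$$ and $$\alpha_{T-t+1}^{-1}=\frac{\frac{1}{\alpha W_{T-t}}\Big(\prod_{i=T-t+2}^{T}a_i\Big)-1-R_{GMV,T-t+1}}{1+s_{T-t+1}},\qquad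 a_i=\frac{1+R_{GMV,i}}{(1+R_{GMV,i})^2+(1+s_i)V_{GMV,i}},$$ where $$R_{GMV,i}=\frac{\mathbf{1}'\boldsymbol{\Sigma}_i^{-1}\boldsymbol{\mu}_i}{\mathbf{1}'\boldsymbol{\Sigma}_i^{-1}\mathbf{1}},\qquad V_{GMV,i}=\frac{1}{\mathbf{1}'\boldsymbol{\Sigma}_i^{-1}\mathbf{1}},\qquad s_i=\boldsymbol{\mu}_i'\mathbf{Q}_i\boldsymbol{\mu}_i .$$
   Context: $(\mathcal{F}_\tau)$ is the filtration of information available to the investor, $E_t(\cdot)=E(\cdot\mid\mathcal{F}_t)$; independence means that $\mathbf{X}_\tau$ is independent of $\mathcal{F}_{\tau-1}$, so conditional and unconditional moments coincide. $\mathbf{1}$ is the $k$-vector of ones, $'$ denotes transpose, and empty products equal $1$. The symbol $\alpha_{T-t+1}^{-1}$ simply denotes the displayed real number (possibly zero). The investor has initial wealth $W_0$ and invests over $T$ periods. At each time $s=0,\ldots,T-1$ a vector $\mathbf{w}_s\in\mathbb{R}^k$ of portfolio weights with $\mathbf{w}_s'\mathbf{1}=1$ is chosen, depending only on $\mathcal{F}_s$; short-selling is allowed. The wealth evolves as $W_t=W_{t-1}(1+\mathbf{w}_{t-1}'\mathbf{X}_t)$, and the utility function is $U(W)=W-\frac{\alpha}{2}W^2$ with $\alpha>0$. Optimality is in the sense of dynamic programming: the value function is $V(t,W_t,\mathcal{F}_t)=\max_{\{\mathbf{w}_s:\mathbf{w}_s'\mathbf{1}=1\}_{s=t}^{T-1}}E_t[U(W_T)]$,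 with $V(T,W_T,\mathcal{F}_T)=U(W_T)$, and satisfies $V(T-t,W_{T-t},\mathcal{F}_{T-t})=\max_{\mathbf{w}_{T-t}:\mathbf{w}_{T-t}'\mathbf{1}=1}E_{T-t}[V(T-t+1,W_{T-t}(1+\mathbf{w}_{T-t}'\mathbf{X}_{T-t+1}),\mathcal{F}_{T-t+1})]$. The weights $\mathbf{w}^*_{T-t}$ are the maximizer at time $T-t$, as a function of the current wealth $W_{T-t}$, assumed nonzero. *)

theory Defs
  imports "HOL-Probability.Probability"
begin

section \<open>Returns\<close>

definition positive_definite :: "real^'k^'k \<Rightarrow> bool" where
  "positive_definite A \<longleftrightarrow> transpose A = A \<and> (\<forall>x. x \<noteq> 0 \<longrightarrow> 0 < x \<bullet> (A *v x))"

definition covariance_matrix :: "'a measure \<Rightarrow> ('a \<Rightarrow> real^'k) \<Rightarrow> real^'k^'k" where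
  "covariance_matrix M Y =
     (\<chi> i j. integral\<^sup>L M (\<lambda>\<omega>. (Y \<omega> $ i - integral\<^sup>L M Y $ i) * (Y \<omega> $ j - integral\<^sup>L M Y $ j)))"

text \<open>Independence of the returns is meant relative to the information filtration; since the
  returns are adapted, this entails that the vectors \<open>X 0, \<dots>, X T\<close> are mutually independent.
  \<open>F 0\<close> need not be trivial.\<close>

locale independent_returns = prob_space M + filtration "space M" F
  for M :: "'a measure" and F :: "nat \<Rightarrow> 'a measure" +
  fixes X :: "nat \<Rightarrow> 'a \<Rightarrow> real^'k"
    and \<mu> :: "nat \<Rightarrow> real^'k" and \<Sigma> :: "nat \<Rightarrow> real^'k^'k" and T :: nat
  assumes subalg: "\<And>\<tau>. subalgebra M (F \<tau>)"
    and adapted: "\<And>\<tau>. \<tau> \<le> T \<Longrightarrow> X \<tau> \<in> F \<tau> \<rightarrow>\<^sub>M borel"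
    and indep: "\<And>\<tau>. 1 \<le> \<tau> \<Longrightarrow> \<tau> \<le> T \<Longrightarrow>
      indep_set (sets (F (\<tau> - 1))) {X \<tau> -` B \<inter> space M | B. B \<in> sets borel}"
    and square_integrable: "\<And>\<tau>. \<tau> \<le> T \<Longrightarrow> integrable M (\<lambda>\<omega>. (norm (X \<tau> \<omega>))\<^sup>2)"
    and mean: "\<And>\<tau>. \<tau> \<le> T \<Longrightarrow> integral\<^sup>L M (X \<tau>) = \<mu> \<tau>"
    and covariance: "\<And>\<tau>. \<tau> \<le> T \<Longrightarrow> covariance_matrix M (X \<tau>) = \<Sigma> \<tau>"
    and pos_def: "\<And>\<tau>. \<tau> \<le> T \<Longrightarrow> positive_definite (\<Sigma> \<tau>)"


section \<open>The portfolio choice problem\<close>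

text \<open>\<open>1 :: real^'k\<close> is the vector all of whose entries are one.\<close>

definition trading_strategy ::
    "'a measure \<Rightarrow> (nat \<Rightarrow> 'a measure) \<Rightarrow> nat \<Rightarrow> (nat \<Rightarrow> 'a \<Rightarrow> real^'k) \<Rightarrow> bool" where
  "trading_strategy M F T w \<longleftrightarrow>
     (\<forall>s<T. w s \<in> F s \<rightarrow>\<^sub>M borel \<and> (\<forall>\<omega>\<in>space M. w s \<omega> \<bullet> 1 = 1))"

primrec wealth ::
    "real \<Rightarrow> (nat \<Rightarrow> 'a \<Rightarrow> real^'k) \<Rightarrow> (nat \<Rightarrow> 'a \<Rightarrow> real^'k) \<Rightarrow> nat \<Rightarrow> 'a \<Rightarrow> real" where
  "wealth W\<^sub>0 X w 0 \<omega> = W\<^sub>0"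
| "wealth W\<^sub>0 X w (Suc t) \<omega> = wealth W\<^sub>0 X w t \<omega> * (1 + w t \<omega> \<bullet> X (Suc t) \<omega>)"

definition utility :: "real \<Rightarrow> real \<Rightarrow> real" where
  "utility \<alpha> W = W - \<alpha> / 2 * W\<^sup>2"

text \<open>Integrability of the terminal utility makes its conditional expectations meaningful
  (\<^const>\<open>real_cond_exp\<close> returns junk values otherwise). Quadratic utility is bounded above, so
  this only excludes strategies of expected utility \<open>-\<infinity>\<close>.\<close>

definition admissible ::
    "'a measure \<Rightarrow> (nat \<Rightarrow> 'a measure) \<Rightarrow> (nat \<Rightarrow> 'a \<Rightarrow> real^'k) \<Rightarrow> nat \<Rightarrow> real \<Rightarrow> real
      \<Rightarrow> (nat \<Rightarrow> 'a \<Rightarrow> real^'k) \<Rightarrow> bool" where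
  "admissible M F X T \<alpha> W\<^sub>0 w \<longleftrightarrow>
     trading_strategy M F T w \<and> integrable M (\<lambda>\<omega>. utility \<alpha> (wealth W\<^sub>0 X w T \<omega>))"

text \<open>The continuation \<open>w n, \<dots>, w (T - 1)\<close> attains the maximum that defines the value function
  at time \<open>n\<close> and current wealth \<open>wealth W\<^sub>0 X w n\<close>. The competitors \<open>w'\<close> agree with \<open>w\<close> before
  time \<open>n\<close>, hence start from the same current wealth, and are arbitrary from \<open>n\<close> on. The past
  of \<open>w\<close> is not required to be optimal.\<close>

definition optimal_from ::
    "'a measure \<Rightarrow> (nat \<Rightarrow> 'a measure) \<Rightarrow> (nat \<Rightarrow> 'a \<Rightarrow> real^'k) \<Rightarrow> nat \<Rightarrow> real \<Rightarrow> real \<Rightarrow> nat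
      \<Rightarrow> (nat \<Rightarrow> 'a \<Rightarrow> real^'k) \<Rightarrow> bool" where
  "optimal_from M F X T \<alpha> W\<^sub>0 n w \<longleftrightarrow>
     admissible M F X T \<alpha> W\<^sub>0 w \<and>
     (\<forall>w'. admissible M F X T \<alpha> W\<^sub>0 w' \<and> (\<forall>s<n. \<forall>\<omega>\<in>space M. w' s \<omega> = w s \<omega>) \<longrightarrow>
        (AE \<omega> in M. real_cond_exp M (F n) (\<lambda>\<omega>. utility \<alpha> (wealth W\<^sub>0 X w' T \<omega>)) \<omega>
                  \<le> real_cond_exp M (F n) (\<lambda>\<omega>. utility \<alpha> (wealth W\<^sub>0 X w T \<omega>)) \<omega>))"


section \<open>The portfolio weights\<close>

definition R_GMV :: "real^'k^'k \<Rightarrow> real^'k \<Rightarrow> real" where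
  "R_GMV S m = (1 \<bullet> (matrix_inv S *v m)) / (1 \<bullet> (matrix_inv S *v 1))"

definition V_GMV :: "real^'k^'k \<Rightarrow> real" where
  "V_GMV S = 1 / (1 \<bullet> (matrix_inv S *v 1))"

text \<open>\<open>\<chi> i j. 1\<close> is the matrix \<open>1 1'\<close>.\<close>

definition Q_mat :: "real^'k^'k \<Rightarrow> real^'k^'k" where
  "Q_mat S = matrix_inv S -
     (1 / (1 \<bullet> (matrix_inv S *v 1))) *\<^sub>R (matrix_inv S ** (\<chi> i j. 1) ** matrix_inv S)"

definition s_slope :: "real^'k^'k \<Rightarrow> real^'k \<Rightarrow> real" where
  "s_slope S m = m \<bullet> (Q_mat S *v m)"

definition a_coeff :: "real^'k^'k \<Rightarrow> real^'k \<Rightarrow> real" where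
  "a_coeff S m =
     (1 + R_GMV S m) / ((1 + R_GMV S m)\<^sup>2 + (1 + s_slope S m) * V_GMV S)"

definition alpha_inv ::
    "real \<Rightarrow> (nat \<Rightarrow> real^'k) \<Rightarrow> (nat \<Rightarrow> real^'k^'k) \<Rightarrow> nat \<Rightarrow> nat \<Rightarrow> real \<Rightarrow> real" where
  "alpha_inv \<alpha> \<mu> \<Sigma> T \<tau> W =
     (1 / (\<alpha> * W) * (\<Prod>i=\<tau>+1..T. a_coeff (\<Sigma> i) (\<mu> i)) - 1 - R_GMV (\<Sigma> \<tau>) (\<mu> \<tau>))
       / (1 + s_slope (\<Sigma> \<tau>) (\<mu> \<tau>))"

text \<open>Weights chosen at time \<open>\<tau> - 1\<close>, when the wealth is \<open>W\<close>, for the return \<open>X \<tau>\<close>.\<close>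

definition optimal_weights ::
    "real \<Rightarrow> (nat \<Rightarrow> real^'k) \<Rightarrow> (nat \<Rightarrow> real^'k^'k) \<Rightarrow> nat \<Rightarrow> nat \<Rightarrow> real \<Rightarrow> real^'k" where
  "optimal_weights \<alpha> \<mu> \<Sigma> T \<tau> W =
     (1 / (1 \<bullet> (matrix_inv (\<Sigma> \<tau>) *v 1))) *\<^sub>R (matrix_inv (\<Sigma> \<tau>) *v 1)
       + alpha_inv \<alpha> \<mu> \<Sigma> T \<tau> W *\<^sub>R (Q_mat (\<Sigma> \<tau>) *v \<mu> \<tau>)"

end

theory Submission
  imports Defs
begin

text \<open>Maximizing quadratic utility means minimizing the mean squared distance of the terminal wealth
  from \<open>1 / \<alpha>\<close>. In terms of the invested amounts \<open>W w\<close>, completing the square turns the expected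
  squared distance from a target after one period into a positive multiple of the squared distance of
  the current wealth from the target scaled by \<open>a_coeff\<close>, plus a constant, plus a positive definite
  form in the deviation from an amount that is affine in \<open>W\<close>. Iterating, the loss
  of any strategy is the same constant plus a weighted sum of expected deviation terms, and the
  claimed weights make all of them vanish.

  Conversely, at zero wealth the amount is forced to be zero and the deviation term is an unavoidable
  constant. The claimed weights may drive the wealth to zero, so an optimal strategy is compared with
  small perturbations of them. For generic perturbations the wealth almost surely vanishes only when it
  vanished before or when all assets lose everything, in which case every strategy is ruined. So the
  competitor pays at most the unavoidable constants of the given strategy plus an arbitrarily small
  amount.\<close>

section \<open>Completing the square\<close>

text \<open>\<open>W\<close> times the global minimum variance portfolio plus a multiple of the
  zero-cost direction \<open>Q_mat S *v m\<close>. Amounts are used instead of weights because they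
  are affine in \<open>W\<close>, hence also meaningful at \<open>W = 0\<close>. The parameter
  \<open>b\<close> is the wealth aimed at one period later.\<close>

definition opt_amount :: "real^'k^'k \<Rightarrow> real^'k \<Rightarrow> real \<Rightarrow> real \<Rightarrow> real^'k" where
  "opt_amount S m b W =
     (W / (1 \<bullet> (matrix_inv S *v 1))) *\<^sub>R (matrix_inv S *v 1)
       + ((b - (1 + R_GMV S m) * W) / (1 + s_slope S m)) *\<^sub>R (Q_mat S *v m)"

text \<open>The second moment of \<open>d \<bullet> Y\<close> for a random vector \<open>Y\<close>
  with mean \<open>m\<close> and covariance \<open>S\<close>.\<close>

definition excess_loss :: "real^'k^'k \<Rightarrow> real^'k \<Rightarrow> real^'k \<Rightarrow> real" where
  "excess_loss S m d = (d \<bullet> m)\<^sup>2 + d \<bullet> (S *v d)"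

text \<open>The least second moment of the gross return over all fully invested portfolios: the case
  \<open>W = 1\<close>, \<open>b = 0\<close> of \<open>second_moment_eq\<close>.\<close>

definition loss_factor :: "real^'k^'k \<Rightarrow> real^'k \<Rightarrow> real" where
  "loss_factor S m = V_GMV S + (1 + R_GMV S m)\<^sup>2 / (1 + s_slope S m)"

text \<open>The loss that remains when both the wealth and the invested amount are ideal for the
  target \<open>b\<close>. The denominator equals that of \<open>a_coeff\<close>.\<close>

definition base_loss :: "real^'k^'k \<Rightarrow> real^'k \<Rightarrow> real \<Rightarrow> real" where
  "base_loss S m b = b\<^sup>2 * V_GMV S / ((1 + s_slope S m) * loss_factor S m)"

lemma Q_mat_mult_vec:
  fixes S :: "real^'k^'k"
  shows "Q_mat S *v x = matrix_inv S *v x - ((1 \<bullet> (matrix_inv S *v x)) / (1 \<bullet> (matrix_inv S *v 1))) *\<^sub>R (matrix_inv S *v 1)"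
proof -
  have "(\<chi> i j. 1) *v y = (1 \<bullet> y) *\<^sub>R (1 :: real^'k)" for y :: "real^'k"
    by (simp add: vec_eq_iff matrix_vector_mult_def inner_vec_def)
  then show ?thesis
    by (simp add: Q_mat_def matrix_vector_mult_diff_rdistrib scaleR_matrix_vector_assoc[symmetric]
        matrix_vector_mul_assoc[symmetric] matrix_vector_mult_scaleR)
qed

section \<open>Algebra of a positive definite covariance matrix\<close>

context
  fixes S :: "real^'k^'k"
  assumes pd: "positive_definite S"
begin

lemma pd_pos: "x \<noteq> 0 \<Longrightarrow> 0 < x \<bullet> (S *v x)"
  using pd by (simp add: positive_definite_def)

lemma pd_nonneg: "0 \<le> x \<bullet> (S *v x)"
  using pd_pos[of x] by (cases "x = 0") auto

lemma pd_sym: "x \<bullet> (S *v y) = y \<bullet> (S *v x)"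
  using pd dot_lmul_matrix[of x S y]
  by (metis positive_definite_def inner_commute transpose_matrix_vector)

text \<open>Positive definiteness excludes a kernel, and an injective square matrix is invertible,
  so \<open>matrix_inv\<close> is a genuine inverse.\<close>

lemma pd_mult_inv: "S *v (matrix_inv S *v x) = x"
proof -
  have "inj ((*v) S)"
    unfolding linear_injective_0[OF matrix_vector_mul_linear]
    using pd_pos by (metis inner_zero_right less_irrefl)
  then have "invertible S"
    by (metis invertible_left_inverse matrix_left_invertible_injective)
  then have "S ** matrix_inv S = mat 1"
    unfolding invertible_def matrix_inv_def by (rule someI2_ex) simp
  then show ?thesis
    by (simp add: matrix_vector_mul_assoc)
qed

lemma pd_inv_one_pos: "0 < 1 \<bullet> (matrix_inv S *v 1)"
proof -
  let ?y = "matrix_inv S *v 1"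
  have "(1 :: real^'k) \<noteq> 0" by simp
  then have "?y \<noteq> 0" using pd_mult_inv[of 1] by auto
  then have "0 < ?y \<bullet> (S *v ?y)" by (rule pd_pos)
  then show ?thesis by (simp add: pd_mult_inv inner_commute)
qed

lemma V_GMV_pos: "0 < V_GMV S"
  using pd_inv_one_pos by (simp add: V_GMV_def)

lemma one_inner_Q_mat: "1 \<bullet> (Q_mat S *v x) = 0"
  using pd_inv_one_pos by (simp add: Q_mat_mult_vec inner_diff_right)

text \<open>This is the first-order condition behind \<open>Q_mat\<close>: up to a multiple of the
  constraint normal \<open>1\<close>, the vector \<open>Q_mat S *v m\<close> solves
  \<open>S *v x = m\<close>.\<close>

lemma pd_mult_Q_mat: "S *v (Q_mat S *v m) = m - R_GMV S m *\<^sub>R 1"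
  by (simp add: Q_mat_mult_vec R_GMV_def matrix_vector_mult_diff_distrib matrix_vector_mult_scaleR pd_mult_inv)

text \<open>Since \<open>Q_mat S *v m\<close> is orthogonal to \<open>1\<close>, the multiple of
  \<open>1\<close> in \<open>pd_mult_Q_mat\<close> drops out, and the slope is the variance of the
  portfolio \<open>Q_mat S *v m\<close>.\<close>

lemma s_slope_nonneg: "0 \<le> s_slope S m"
proof -
  have "s_slope S m = (Q_mat S *v m) \<bullet> (S *v (Q_mat S *v m))"
    using one_inner_Q_mat[of m] by (simp add: pd_mult_Q_mat s_slope_def inner_diff_right inner_commute)
  then show ?thesis by (simp add: pd_nonneg)
qed

lemma loss_factor_pos: "0 < loss_factor S m"
  unfolding loss_factor_def using s_slope_nonneg[of m] V_GMV_pos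
  by (intro add_pos_nonneg) auto

lemma base_loss_nonneg: "0 \<le> base_loss S m b"
  unfolding base_loss_def using s_slope_nonneg[of m] V_GMV_pos loss_factor_pos[of m]
  by (intro divide_nonneg_nonneg mult_nonneg_nonneg) auto

lemma excess_loss_nonneg: "0 \<le> excess_loss S m d"
  by (simp add: excess_loss_def pd_nonneg)

lemma excess_loss_eq_0_iff: "excess_loss S m d = 0 \<longleftrightarrow> d = 0"
  using pd_pos[of d] by (auto simp: excess_loss_def)
    (metis add_nonneg_pos less_irrefl zero_le_power2)

lemma opt_amount_inner_one: "opt_amount S m b W \<bullet> 1 = W"
proof -
  have "1 \<bullet> opt_amount S m b W = W"
    using pd_inv_one_pos one_inner_Q_mat[of m] by (simp add: opt_amount_def inner_add_right)
  then show ?thesis by (simp only: inner_commute)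
qed

text \<open>The left side is the expected squared distance of next-period wealth from
  \<open>b\<close>. Split \<open>v = z + d\<close> with \<open>z\<close> the optimal amount. As
  \<open>S *v z\<close> lies in the span of \<open>1\<close> and \<open>m\<close> while
  \<open>d\<close> is orthogonal to \<open>1\<close>, the cross terms from the squared mean and from
  the variance are opposite multiples of \<open>d \<bullet> m\<close> and cancel. The rest is a
  quadratic polynomial in \<open>W\<close>, completed to a square.\<close>

lemma second_moment_eq:
  fixes m v :: "real^'k"
  assumes v: "v \<bullet> 1 = W"
  shows "(W - b + v \<bullet> m)\<^sup>2 + v \<bullet> (S *v v) =
     loss_factor S m * (W - b * a_coeff S m)\<^sup>2 + (base_loss S m b + excess_loss S m (v - opt_amount S m b W))"
proof -
  define g where "g = (1 / (1 \<bullet> (matrix_inv S *v 1))) *\<^sub>R (matrix_inv S *v 1)"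
  define q where "q = Q_mat S *v m"
  define R s V where "R = R_GMV S m" and "s = s_slope S m" and "V = V_GMV S"
  \<comment> \<open>\<open>c\<close> turns out to be the expected shortfall
    \<open>b - (W + z \<bullet> m)\<close> at the optimal amount \<open>z\<close>.\<close>
  define c where "c = (b - (1 + R) * W) / (1 + s)"
  define z where "z = opt_amount S m b W"
  define d where "d = v - z"
  have s: "0 \<le> s" and V: "0 < V" using s_slope_nonneg V_GMV_pos by (auto simp: s_def V_def)
  have z: "z = W *\<^sub>R g + c *\<^sub>R q"
    by (simp add: z_def opt_amount_def g_def q_def c_def R_def s_def)
  have Sg: "S *v g = V *\<^sub>R 1"
    by (simp add: g_def matrix_vector_mult_scaleR pd_mult_inv V_def V_GMV_def)
  have Sq: "S *v q = m - R *\<^sub>R 1" by (simp add: q_def R_def pd_mult_Q_mat)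
  have q1: "q \<bullet> 1 = 0" using one_inner_Q_mat[of m] by (simp add: q_def inner_commute)
  have qm: "q \<bullet> m = s" by (simp add: q_def s_def s_slope_def inner_commute)
  have g1: "g \<bullet> 1 = 1" using pd_inv_one_pos by (simp add: g_def inner_commute)
  have "g \<bullet> (S *v q) = q \<bullet> (S *v g)" by (rule pd_sym)
  then have gm: "g \<bullet> m = R" by (simp add: Sq Sg inner_diff_right g1 q1)
  have z1: "z \<bullet> 1 = W" using opt_amount_inner_one by (simp add: z_def)
  have d1: "d \<bullet> 1 = 0" using v z1 by (simp add: d_def inner_diff_left)
  have Sz: "S *v z = (W * V - c * R) *\<^sub>R 1 + c *\<^sub>R m"
    by (simp add: z matrix_vector_right_distrib matrix_vector_mult_scaleR Sg Sq algebra_simps)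
  have zm: "z \<bullet> m = W * R + c * s" by (simp add: z inner_add_left gm qm)
  have dSz: "d \<bullet> (S *v z) = c * (d \<bullet> m)" by (simp add: Sz inner_add_right d1)
  have zSz: "z \<bullet> (S *v z) = W\<^sup>2 * V + c\<^sup>2 * s"
    by (simp add: Sz inner_add_right z1 zm power2_eq_square algebra_simps)
  have vzd: "v = z + d" by (simp add: d_def)
  have vSv: "v \<bullet> (S *v v) = W\<^sup>2 * V + c\<^sup>2 * s + 2 * c * (d \<bullet> m) + d \<bullet> (S *v d)"
    unfolding vzd using pd_sym[of z d]
    by (simp add: matrix_vector_right_distrib inner_add_left inner_add_right zSz dSz)
  have c1: "c * (1 + s) = b - (1 + R) * W" using s by (simp add: c_def)
  then have vm: "W - b + v \<bullet> m = (d \<bullet> m) - c"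
    unfolding vzd by (simp add: inner_add_left zm algebra_simps)
  have "(W - b + v \<bullet> m)\<^sup>2 + v \<bullet> (S *v v) = (W\<^sup>2 * V + (1 + s) * c\<^sup>2) + ((d \<bullet> m)\<^sup>2 + d \<bullet> (S *v d))"
    unfolding vm vSv by (simp add: power2_eq_square algebra_simps)
  moreover have "W\<^sup>2 * V + (1 + s) * c\<^sup>2 = loss_factor S m * (W - b * a_coeff S m)\<^sup>2 + base_loss S m b"
  proof -
    have 1: "(1 + s) * c\<^sup>2 = (b - (1 + R) * W)\<^sup>2 / (1 + s)"
      using s by (simp add: c_def power_divide power2_eq_square)
    define D where "D = (1 + R)\<^sup>2 + (1 + s) * V"
    have D: "D > 0" unfolding D_def using s V by (intro add_nonneg_pos) auto
    have lf: "loss_factor S m = D / (1 + s)"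
      using s by (simp add: loss_factor_def R_def[symmetric] s_def[symmetric] V_def[symmetric] D_def field_simps)
    have ac: "a_coeff S m = (1 + R) / D"
      by (simp add: a_coeff_def R_def[symmetric] s_def[symmetric] V_def[symmetric] D_def)
    have bl: "base_loss S m b = b\<^sup>2 * V / D"
      using s by (simp add: base_loss_def lf s_def[symmetric] V_def[symmetric])
    \<comment> \<open>Multiplying by \<open>(1 + s) * D\<close> clears all denominators, so that the
      claim reduces to a polynomial identity.\<close>
    have "(1 + s) * D * (W\<^sup>2 * V + (b - (1 + R) * W)\<^sup>2 / (1 + s)) = D * ((1 + s) * W\<^sup>2 * V + (b - (1 + R) * W)\<^sup>2)"
      using s by (simp add: field_simps)
    also have "\<dots> = (D * W - b * (1 + R))\<^sup>2 + (1 + s) * (b\<^sup>2 * V)"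
      unfolding D_def by algebra
    also have "\<dots> = (1 + s) * D * (D / (1 + s) * (W - b * ((1 + R) / D))\<^sup>2 + b\<^sup>2 * V / D)"
    proof -
      have "W - b * ((1 + R) / D) = (D * W - b * (1 + R)) / D" using D by (simp add: field_simps)
      then have "D / (1 + s) * (W - b * ((1 + R) / D))\<^sup>2 = (D * W - b * (1 + R))\<^sup>2 / ((1 + s) * D)"
        using D by (simp add: power_divide power2_eq_square)
      then show ?thesis using s D by (simp add: distrib_left)
    qed
    finally show ?thesis unfolding 1 lf ac bl using s D by simp
  qed
  ultimately show ?thesis by (simp add: excess_loss_def d_def z_def)
qed

end

text \<open>Multiplying the weights by the wealth removes the \<open>1 / W\<close> in
  \<open>alpha_inv\<close>; the target is \<open>1 / \<alpha>\<close> scaled by the coefficients of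
  all later periods.\<close>

lemma optimal_weights_eq:
  assumes "W \<noteq> 0"
  shows "optimal_weights \<alpha> \<mu> \<Sigma> T \<tau> W =
    (1 / W) *\<^sub>R opt_amount (\<Sigma> \<tau>) (\<mu> \<tau>) (1 / \<alpha> * (\<Prod>i=\<tau>+1..T. a_coeff (\<Sigma> i) (\<mu> i))) W"
proof -
  have "alpha_inv \<alpha> \<mu> \<Sigma> T \<tau> W =
      (1 / W) * ((1 / \<alpha> * (\<Prod>i=\<tau>+1..T. a_coeff (\<Sigma> i) (\<mu> i)) - (1 + R_GMV (\<Sigma> \<tau>) (\<mu> \<tau>)) * W) / (1 + s_slope (\<Sigma> \<tau>) (\<mu> \<tau>)))"
  proof -
    have "1 / (\<alpha> * W) * P - 1 - R = (1 / W) * (1 / \<alpha> * P - (1 + R) * W)" for P R :: real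
      using assms by (simp add: diff_divide_distrib algebra_simps)
    then show ?thesis unfolding alpha_inv_def by simp
  qed
  then show ?thesis
    using assms by (simp add: optimal_weights_def opt_amount_def scaleR_add_right)
qed

section \<open>Independence, generic shifts and conditional expectations\<close>

text \<open>Freezing the known argument: independence makes the law of the pair a product measure,
  as is checked on rectangles, and Tonelli applies. With nonnegative \<open>f\<close> no
  integrability has to be tracked.\<close>

lemma (in prob_space) nn_integral_indep:
  assumes F: "subalgebra M F"
    and Z: "Z \<in> F \<rightarrow>\<^sub>M N" and Y: "Y \<in> M \<rightarrow>\<^sub>M L"
    and ind: "indep_set (sets F) {Y -` B \<inter> space M | B. B \<in> sets L}"
    and f[measurable]: "f \<in> borel_measurable (N \<Otimes>\<^sub>M L)"
  shows "(\<integral>\<^sup>+\<omega>. f (Z \<omega>, Y \<omega>) \<partial>M) = (\<integral>\<^sup>+\<omega>. (\<integral>\<^sup>+\<omega>'. f (Z \<omega>, Y \<omega>') \<partial>M) \<partial>M)"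
proof -
  have Z'[measurable]: "Z \<in> M \<rightarrow>\<^sub>M N" by (rule measurable_from_subalg[OF F Z])
  note Y[measurable]
  interpret L: prob_space "distr M L Y" by (rule prob_space_distr) simp
  have sp: "space F = space M" using F by (simp add: subalgebra_def)
  have "distr M N Z \<Otimes>\<^sub>M distr M L Y = distr M (N \<Otimes>\<^sub>M L) (\<lambda>\<omega>. (Z \<omega>, Y \<omega>))"
  proof (rule pair_measure_eqI)
    fix A B assume "A \<in> sets (distr M N Z)" "B \<in> sets (distr M L Y)"
    then have A[measurable]: "A \<in> sets N" and B[measurable]: "B \<in> sets L" by simp_all
    have "Z -` A \<inter> space M \<in> sets F" using measurable_sets[OF Z A] by (simp add: sp)
    then have "prob ((Z -` A \<inter> space M) \<inter> (Y -` B \<inter> space M)) = prob (Z -` A \<inter> space M) * prob (Y -` B \<inter> space M)"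
      using B by (intro indep_setD[OF ind]) auto
    moreover have "(\<lambda>\<omega>. (Z \<omega>, Y \<omega>)) -` (A \<times> B) \<inter> space M = (Z -` A \<inter> space M) \<inter> (Y -` B \<inter> space M)" by auto
    ultimately show "emeasure (distr M N Z) A * emeasure (distr M L Y) B =
        emeasure (distr M (N \<Otimes>\<^sub>M L) (\<lambda>\<omega>. (Z \<omega>, Y \<omega>))) (A \<times> B)"
      by (simp add: emeasure_distr emeasure_eq_measure ennreal_mult)
  next
    show "sigma_finite_measure (distr M N Z)"
      by (rule prob_space_imp_sigma_finite[OF prob_space_distr]) simp
    show "sigma_finite_measure (distr M L Y)" ..
  qed simp
  then have "(\<integral>\<^sup>+\<omega>. f (Z \<omega>, Y \<omega>) \<partial>M) = (\<integral>\<^sup>+z. f z \<partial>(distr M N Z \<Otimes>\<^sub>M distr M L Y))"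
    by (simp add: nn_integral_distr)
  also have "\<dots> = (\<integral>\<^sup>+z. \<integral>\<^sup>+y. f (z, y) \<partial>distr M L Y \<partial>distr M N Z)"
    by (rule L.nn_integral_fst[symmetric]) simp
  also have "\<dots> = (\<integral>\<^sup>+\<omega>. \<integral>\<^sup>+y. f (Z \<omega>, y) \<partial>distr M L Y \<partial>M)"
    by (subst nn_integral_distr) simp_all
  also have "\<dots> = (\<integral>\<^sup>+\<omega>. (\<integral>\<^sup>+\<omega>'. f (Z \<omega>, Y \<omega>') \<partial>M) \<partial>M)"
    by (intro nn_integral_cong, subst nn_integral_distr) (use measurable_space[OF Z'] in \<open>simp_all add: measurable_Pair2\<close>)
  finally show ?thesis .
qed

text \<open>Squared mean plus variance: expand around the mean, where the linear term has
  expectation zero.\<close>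

lemma (in prob_space) second_moment_affine:
  fixes Y :: "'a \<Rightarrow> real^'k"
  assumes Y[measurable]: "Y \<in> borel_measurable M" and sq: "integrable M (\<lambda>\<omega>. (norm (Y \<omega>))\<^sup>2)"
  shows "(\<integral>\<^sup>+\<omega>. ennreal ((y + v \<bullet> Y \<omega>)\<^sup>2) \<partial>M) =
    ennreal ((y + v \<bullet> expectation Y)\<^sup>2 + v \<bullet> (covariance_matrix M Y *v v))"
proof -
  let ?m = "expectation Y"
  have Y1: "integrable M Y"
  proof -
    have "integrable M (\<lambda>\<omega>. norm (Y \<omega>))"
      by (rule square_integrable_imp_integrable) (use sq in simp_all)
    then show ?thesis by (simp add: integrable_norm_iff)
  qed
  have comp: "integrable M (\<lambda>\<omega>. Y \<omega> $ i)" for i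
    using integrable_inner_left[OF Y1, of "axis i 1"] by (simp add: inner_axis)
  have prod: "integrable M (\<lambda>\<omega>. (Y \<omega> $ i) * (Y \<omega> $ j))" for i j
  proof (rule Bochner_Integration.integrable_bound[OF sq])
    show "AE \<omega> in M. norm (Y \<omega> $ i * Y \<omega> $ j) \<le> norm ((norm (Y \<omega>))\<^sup>2)"
      by (intro AE_I2) (simp add: abs_mult power2_eq_square component_le_norm_cart mult_mono)
  qed (use comp in \<open>auto intro!: borel_measurable_times borel_measurable_integrable\<close>)
  have cc: "integrable M (\<lambda>\<omega>. (Y \<omega> $ i - ?m $ i) * (Y \<omega> $ j - ?m $ j))" for i j
    using prod comp by (simp add: left_diff_distrib right_diff_distrib)
  have vm: "v \<bullet> ?m = expectation (\<lambda>\<omega>. v \<bullet> Y \<omega>)" using Y1 by simp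
  \<comment> \<open>The double sum is the square of \<open>v \<bullet> (Y \<omega> - ?m)\<close>,
    written in coordinates to match the entrywise covariance matrix.\<close>
  have ex: "(y + v \<bullet> Y \<omega>)\<^sup>2 = (y + v \<bullet> ?m)\<^sup>2 + 2 * (y + v \<bullet> ?m) * (v \<bullet> Y \<omega> - v \<bullet> ?m)
      + (\<Sum>i\<in>UNIV. v $ i * (\<Sum>j\<in>UNIV. (Y \<omega> $ i - ?m $ i) * (Y \<omega> $ j - ?m $ j) * v $ j))" for \<omega>
  proof -
    have "(\<Sum>i\<in>UNIV. v $ i * (\<Sum>j\<in>UNIV. (Y \<omega> $ i - ?m $ i) * (Y \<omega> $ j - ?m $ j) * v $ j))
        = (v \<bullet> (Y \<omega> - ?m)) * (v \<bullet> (Y \<omega> - ?m))"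
      by (simp add: inner_vec_def sum_product sum_distrib_left ac_simps)
    then show ?thesis by (simp add: inner_diff_right power2_eq_square algebra_simps)
  qed
  have cov: "v \<bullet> (covariance_matrix M Y *v v) =
     (\<Sum>i\<in>UNIV. v $ i * (\<Sum>j\<in>UNIV. expectation (\<lambda>\<omega>. (Y \<omega> $ i - ?m $ i) * (Y \<omega> $ j - ?m $ j)) * v $ j))"
    by (simp add: inner_vec_def matrix_vector_mult_def covariance_matrix_def)
  have int: "integrable M (\<lambda>\<omega>. (y + v \<bullet> Y \<omega>)\<^sup>2)"
    unfolding ex using Y1 cc by simp
  have "expectation (\<lambda>\<omega>. (y + v \<bullet> Y \<omega>)\<^sup>2) = (y + v \<bullet> ?m)\<^sup>2 + v \<bullet> (covariance_matrix M Y *v v)"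
    unfolding ex cov using Y1 cc by (simp add: prob_space)
  then show ?thesis using int by (simp add: nn_integral_eq_integral)
qed

lemma negligible_hyperplane_AE:
  fixes a :: "'b::euclidean_space"
  assumes "a \<noteq> 0"
  shows "AE y in lborel. y \<bullet> a \<noteq> c"
proof -
  have "negligible {y. a \<bullet> y = c}" using assms by (intro negligible_hyperplane) simp
  then have "{y. a \<bullet> y = c} \<in> null_sets lborel"
    by (subst null_sets_completion_iff[symmetric]) (simp_all add: negligible_iff_null_sets)
  from AE_not_in[OF this] show ?thesis by (simp add: inner_commute)
qed

text \<open>Fubini: for fixed \<open>\<omega>\<close> the bad shifts lie on a hyperplane, so almost every shift is good
  for almost every \<open>\<omega>\<close>.\<close>

lemma (in prob_space) exists_generic_shift:
  fixes Y :: "'a \<Rightarrow> real^'k" and Z :: "'a \<Rightarrow> real"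
  assumes [measurable]: "Y \<in> borel_measurable M" "Z \<in> borel_measurable M" and "0 < \<epsilon>"
  shows "\<exists>u. u \<bullet> 1 = 0 \<and> norm u < \<epsilon> \<and> (AE \<omega> in M. Y \<omega> \<notin> range (\<lambda>c. c *\<^sub>R 1) \<longrightarrow> Z \<omega> + u \<bullet> Y \<omega> \<noteq> 0)"
proof -
  \<comment> \<open>\<open>P\<close> is the orthogonal projection onto the complement of
    \<open>1\<close>. Being self-adjoint, it allows the shift to be drawn from the whole space under
    Lebesgue measure and projected afterwards.\<close>
  define P where "P x = x - ((x \<bullet> 1) / real CARD('k)) *\<^sub>R (1 :: real^'k)" for x :: "real^'k"
  have one: "(1 :: real^'k) \<bullet> 1 = real CARD('k)" by (simp add: inner_vec_def)
  have P1: "P x \<bullet> 1 = 0" for x by (simp add: P_def inner_diff_left one)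
  have Pin: "P x \<bullet> y = x \<bullet> P y" for x y
    by (simp add: P_def inner_diff_left inner_diff_right inner_commute)
  have Pr: "y \<in> range (\<lambda>c. c *\<^sub>R 1)" if "P y = 0" for y
    using that by (auto simp: P_def)
  have [measurable]: "P \<in> borel_measurable borel" unfolding P_def by measurable
  interpret pair_sigma_finite M "lborel :: (real^'k) measure" ..
  have "AE \<omega> in M. AE y in lborel. P (Y \<omega>) \<noteq> 0 \<longrightarrow> Z \<omega> + y \<bullet> P (Y \<omega>) \<noteq> 0"
  proof (rule AE_I2)
    fix \<omega>
    show "AE y in lborel. P (Y \<omega>) \<noteq> 0 \<longrightarrow> Z \<omega> + y \<bullet> P (Y \<omega>) \<noteq> 0"
    proof (cases "P (Y \<omega>) = 0")
      case False
      from negligible_hyperplane_AE[OF this, of "- Z \<omega>"] show ?thesis by eventually_elim auto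
    qed simp
  qed
  then have gen: "AE y in lborel. AE \<omega> in M. P (Y \<omega>) \<noteq> 0 \<longrightarrow> Z \<omega> + y \<bullet> P (Y \<omega>) \<noteq> 0"
    by (subst (asm) AE_commute) measurable
  define U where "U = {y. norm (P y) < \<epsilon>}"
  have "open U"
    unfolding U_def P_def by (intro open_Collect_less continuous_intros) simp
  \<comment> \<open>A nonempty open set is not null, so a property of almost every shift is shared
    by some small one.\<close>
  have "\<not> (AE y in lborel. y \<notin> U)"
  proof
    assume "AE y in lborel. y \<notin> U"
    then have "U \<in> null_sets lborel"
      using \<open>open U\<close> by (subst (asm) AE_iff_null_sets[symmetric]) auto
    then have "negligible U"
      by (simp add: negligible_iff_null_sets null_sets_completionI)
    moreover have "0 \<in> U" using \<open>0 < \<epsilon>\<close> by (simp add: U_def P_def)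
    ultimately show False using open_not_negligible[OF \<open>open U\<close>] by auto
  qed
  moreover have "AE y in lborel. y \<notin> U"
    if "\<not> (\<exists>y\<in>U. AE \<omega> in M. P (Y \<omega>) \<noteq> 0 \<longrightarrow> Z \<omega> + y \<bullet> P (Y \<omega>) \<noteq> 0)"
    using gen by eventually_elim (use that in blast)
  ultimately obtain y where "y \<in> U" "AE \<omega> in M. P (Y \<omega>) \<noteq> 0 \<longrightarrow> Z \<omega> + y \<bullet> P (Y \<omega>) \<noteq> 0"
    by blast
  then show ?thesis
    by (intro exI[of _ "P y"]) (use P1 Pin Pr in \<open>auto simp: U_def\<close>)
qed

text \<open>On the event \<open>A\<close> where the difference \<open>h\<close> of the conditional
  expectations is positive, its integral is nonnegative by choice of \<open>A\<close> and
  nonpositive by hypothesis. Hence \<open>A\<close> is null.\<close>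

lemma (in prob_space) real_cond_exp_le:
  assumes F: "subalgebra M F" and f: "integrable M f" and g: "integrable M g"
    and le: "\<And>A. A \<in> sets F \<Longrightarrow> (\<integral>\<omega>\<in>A. f \<omega> \<partial>M) \<le> (\<integral>\<omega>\<in>A. g \<omega> \<partial>M)"
  shows "AE \<omega> in M. real_cond_exp M F f \<omega> \<le> real_cond_exp M F g \<omega>"
proof -
  interpret F: finite_measure_subalgebra M F using F by unfold_locales
  interpret F: sigma_finite_subalgebra M F using F.finite_measure_subalgebra_axioms
    by (rule finite_measure_subalgebra_is_sigma_finite)
  define h where "h \<omega> = real_cond_exp M F f \<omega> - real_cond_exp M F g \<omega>" for \<omega>
  have hF[measurable]: "h \<in> borel_measurable F" unfolding h_def by measurable
  have hM[measurable]: "h \<in> borel_measurable M" unfolding h_def by measurable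
  have hi: "integrable M h" unfolding h_def using f g by (intro Bochner_Integration.integrable_diff F.real_cond_exp_int)
  define A where "A = {\<omega> \<in> space F. 0 < h \<omega>}"
  have A: "A \<in> sets F" unfolding A_def by measurable
  have AM[measurable]: "A \<in> sets M" using A F by (auto simp: subalgebra_def)
  have sp: "space F = space M" using F by (simp add: subalgebra_def)
  have si: "set_integrable M A q" if "integrable M q" for q :: "'a \<Rightarrow> real"
    using that AM unfolding set_integrable_def by (rule integrable_mult_indicator[rotated])
  have "(\<integral>\<omega>\<in>A. h \<omega> \<partial>M) = (\<integral>\<omega>\<in>A. f \<omega> \<partial>M) - (\<integral>\<omega>\<in>A. g \<omega> \<partial>M)"
    unfolding h_def using f g A
    by (subst set_integral_diff) (simp_all add: si F.real_cond_exp_int F.real_cond_exp_intA)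
  then have "(\<integral>\<omega>\<in>A. h \<omega> \<partial>M) \<le> 0" using le[OF A] by simp
  moreover have nn: "0 \<le> indicator A \<omega> *\<^sub>R h \<omega>" for \<omega> by (auto simp: A_def indicator_def)
  ultimately have "(\<integral>\<omega>. indicator A \<omega> *\<^sub>R h \<omega> \<partial>M) = 0"
    unfolding set_lebesgue_integral_def by (intro antisym integral_nonneg_AE AE_I2) auto
  then have "AE \<omega> in M. indicator A \<omega> *\<^sub>R h \<omega> = 0"
    using si[OF hi] nn unfolding set_integrable_def by (subst (asm) integral_nonneg_eq_0_iff_AE) auto
  with AE_space show ?thesis
    by eventually_elim (auto simp: A_def indicator_def h_def sp split: if_splits)
qed

section \<open>Regularity of the loss and utility as a squared distance\<close>

lemma continuous_on_excess_loss: "continuous_on UNIV (excess_loss S m)"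
  unfolding excess_loss_def
  by (intro continuous_intros linear_continuous_on matrix_vector_mul_bounded_linear)

lemma borel_measurable_excess_loss[measurable]: "excess_loss S m \<in> borel_measurable borel"
  by (intro borel_measurable_continuous_onI continuous_on_excess_loss)

lemma borel_measurable_opt_amount[measurable]: "opt_amount S m b \<in> borel_measurable borel"
  unfolding opt_amount_def by measurable

lemma utility_eq:
  assumes "\<alpha> > 0"
  shows "utility \<alpha> W = 1 / (2 * \<alpha>) - \<alpha> / 2 * (W - 1 / \<alpha>)\<^sup>2"
  using assms by (simp add: utility_def power2_eq_square field_simps)

lemma wealth_cong:
  assumes "\<And>s. s < t \<Longrightarrow> w' s \<omega> = w s \<omega>"
  shows "wealth W\<^sub>0 X w' t \<omega> = wealth W\<^sub>0 X w t \<omega>"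
  using assms by (induction t) auto

text \<open>Losses are compared as extended nonnegative integrals, conditional expectations through
  real ones; this passes from the former to the latter.\<close>

lemma (in prob_space) set_integral_mono_nn_integral:
  fixes f g :: "'a \<Rightarrow> real"
  assumes f: "integrable M f" "\<And>\<omega>. 0 \<le> f \<omega>" and g: "integrable M g" "\<And>\<omega>. 0 \<le> g \<omega>"
    and A: "A \<in> events"
    and le: "(\<integral>\<^sup>+\<omega>\<in>A. ennreal (f \<omega>) \<partial>M) \<le> (\<integral>\<^sup>+\<omega>\<in>A. ennreal (g \<omega>) \<partial>M)"
  shows "(\<integral>\<omega>\<in>A. f \<omega> \<partial>M) \<le> (\<integral>\<omega>\<in>A. g \<omega> \<partial>M)"
proof -
  have eq: "(\<integral>\<^sup>+\<omega>\<in>A. ennreal (h \<omega>) \<partial>M) = ennreal (\<integral>\<omega>\<in>A. h \<omega> \<partial>M)"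
    if "integrable M h" "\<And>\<omega>. 0 \<le> h \<omega>" for h :: "'a \<Rightarrow> real"
  proof -
    have "(\<integral>\<^sup>+\<omega>\<in>A. ennreal (h \<omega>) \<partial>M) = (\<integral>\<^sup>+\<omega>. ennreal (indicator A \<omega> *\<^sub>R h \<omega>) \<partial>M)"
      by (intro nn_integral_cong) (simp add: indicator_def)
    also have "\<dots> = ennreal (\<integral>\<omega>\<in>A. h \<omega> \<partial>M)"
      unfolding set_lebesgue_integral_def using that A
      by (intro nn_integral_eq_integral integrable_mult_indicator) auto
    finally show ?thesis .
  qed
  have "0 \<le> (\<integral>\<omega>\<in>A. g \<omega> \<partial>M)"
    unfolding set_lebesgue_integral_def using g by (intro integral_nonneg_AE) simp
  then show ?thesis using le by (simp add: eq f g)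
qed

text \<open>By \<open>utility_eq\<close>, utility and squared distance are affine functions of each
  other, so admissibility means finite expected loss.\<close>

lemma (in prob_space) integrable_utility_iff:
  assumes "\<alpha> > 0" and [measurable]: "W \<in> borel_measurable M"
  shows "integrable M (\<lambda>\<omega>. utility \<alpha> (W \<omega>)) \<longleftrightarrow> (\<integral>\<^sup>+\<omega>. ennreal ((W \<omega> - 1 / \<alpha>)\<^sup>2) \<partial>M) < \<infinity>"
proof -
  have "integrable M (\<lambda>\<omega>. utility \<alpha> (W \<omega>)) \<longleftrightarrow> integrable M (\<lambda>\<omega>. (W \<omega> - 1 / \<alpha>)\<^sup>2)"
  proof
    assume "integrable M (\<lambda>\<omega>. utility \<alpha> (W \<omega>))"
    then have "integrable M (\<lambda>\<omega>. 2 / \<alpha> * (1 / (2 * \<alpha>) - utility \<alpha> (W \<omega>)))" by simp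
    then show "integrable M (\<lambda>\<omega>. (W \<omega> - 1 / \<alpha>)\<^sup>2)" using assms(1) by (simp add: utility_eq)
  next
    assume "integrable M (\<lambda>\<omega>. (W \<omega> - 1 / \<alpha>)\<^sup>2)"
    then show "integrable M (\<lambda>\<omega>. utility \<alpha> (W \<omega>))" using assms(1) by (simp add: utility_eq)
  qed
  also have "\<dots> \<longleftrightarrow> (\<integral>\<^sup>+\<omega>. ennreal ((W \<omega> - 1 / \<alpha>)\<^sup>2) \<partial>M) < \<infinity>"
    by (simp add: integrable_iff_bounded)
  finally show ?thesis .
qed

section \<open>The loss of a trading strategy\<close>

context independent_returns
begin

text \<open>Here \<open>t\<close> is a decision time and the products run over the returns still to
  come. In \<open>terminal_loss\<close>, \<open>factor t\<close> weighs the squared distance of the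
  wealth at time \<open>t\<close> from \<open>target \<alpha> t\<close>.\<close>

definition factor :: "nat \<Rightarrow> real" where
  "factor t = (\<Prod>i=t+1..T. loss_factor (\<Sigma> i) (\<mu> i))"

definition target :: "real \<Rightarrow> nat \<Rightarrow> real" where
  "target \<alpha> t = 1 / \<alpha> * (\<Prod>i=t+1..T. a_coeff (\<Sigma> i) (\<mu> i))"

text \<open>The decision at time \<open>t\<close> faces the return with index \<open>Suc t\<close>,
  hence the shift here and in the next two definitions.\<close>

definition opt_invest :: "real \<Rightarrow> nat \<Rightarrow> real \<Rightarrow> real^'k" where
  "opt_invest \<alpha> t = opt_amount (\<Sigma> (Suc t)) (\<mu> (Suc t)) (target \<alpha> (Suc t))"

definition fixed_loss :: "real \<Rightarrow> nat \<Rightarrow> real" where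
  "fixed_loss \<alpha> t = base_loss (\<Sigma> (Suc t)) (\<mu> (Suc t)) (target \<alpha> (Suc t))"

definition extra_loss :: "real \<Rightarrow> nat \<Rightarrow> real \<Rightarrow> real^'k \<Rightarrow> real" where
  "extra_loss \<alpha> t W v = excess_loss (\<Sigma> (Suc t)) (\<mu> (Suc t)) (W *\<^sub>R v - opt_invest \<alpha> t W)"

lemma borel_measurable_opt_invest[measurable]: "opt_invest \<alpha> t \<in> borel_measurable borel"
  unfolding opt_invest_def by measurable

lemma factor_pos: "0 < factor t"
  unfolding factor_def by (intro prod_pos loss_factor_pos pos_def) simp

lemma factor_T: "factor T = 1" and target_T: "target \<alpha> T = 1 / \<alpha>"
  by (simp_all add: factor_def target_def)

lemma factor_Suc: "t < T \<Longrightarrow> factor t = factor (Suc t) * loss_factor (\<Sigma> (Suc t)) (\<mu> (Suc t))"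
  by (simp add: factor_def prod.atLeast_Suc_atMost mult.commute)

lemma target_Suc: "t < T \<Longrightarrow> target \<alpha> t = target \<alpha> (Suc t) * a_coeff (\<Sigma> (Suc t)) (\<mu> (Suc t))"
  by (simp add: target_def prod.atLeast_Suc_atMost mult.commute)

lemma fixed_loss_nonneg: "t < T \<Longrightarrow> 0 \<le> fixed_loss \<alpha> t"
  unfolding fixed_loss_def by (intro base_loss_nonneg pos_def) simp

lemma extra_loss_nonneg: "t < T \<Longrightarrow> 0 \<le> extra_loss \<alpha> t W v"
  unfolding extra_loss_def by (intro excess_loss_nonneg pos_def) simp

text \<open>The source of uniqueness: positive definiteness leaves only the zero deviation, and a
  nonzero wealth turns amounts back into weights.\<close>

lemma extra_loss_eq_0_iff:
  assumes "t < T" "W \<noteq> 0"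
  shows "extra_loss \<alpha> t W v = 0 \<longleftrightarrow> v = optimal_weights \<alpha> \<mu> \<Sigma> T (t + 1) W"
proof -
  have "extra_loss \<alpha> t W v = 0 \<longleftrightarrow> W *\<^sub>R v = opt_invest \<alpha> t W"
    unfolding extra_loss_def using assms(1) by (subst excess_loss_eq_0_iff[OF pos_def]) auto
  also have "\<dots> \<longleftrightarrow> v = (1 / W) *\<^sub>R opt_invest \<alpha> t W"
    using assms(2) by (auto dest!: sym[of "W *\<^sub>R v"])
  finally show ?thesis
    using assms(2) by (simp add: optimal_weights_eq opt_invest_def target_def)
qed

lemma opt_invest_inner_one: "t < T \<Longrightarrow> opt_invest \<alpha> t W \<bullet> 1 = W"
  unfolding opt_invest_def by (intro opt_amount_inner_one pos_def) simp

section \<open>Adaptedness of the wealth process\<close>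

lemma measurable_from_F: "f \<in> F t \<rightarrow>\<^sub>M N \<Longrightarrow> f \<in> M \<rightarrow>\<^sub>M N"
  by (rule measurable_from_subalg[OF subalg])

lemma measurable_F_mono: "s \<le> t \<Longrightarrow> f \<in> F s \<rightarrow>\<^sub>M N \<Longrightarrow> f \<in> F t \<rightarrow>\<^sub>M N"
  using sets_F_mono[of s t] by (intro measurable_from_subalg[of "F t" "F s"]) (auto simp: subalgebra_def space_F)

lemma sets_F_events: "A \<in> sets (F t) \<Longrightarrow> A \<in> events"
  using subalg[of t] by (auto simp: subalgebra_def)

lemma measurable_X[measurable]: "t \<le> T \<Longrightarrow> X t \<in> borel_measurable M"
  using adapted measurable_from_F by blast

lemma wealth_adapted:
  assumes "trading_strategy M F T w"
  shows "t \<le> T \<Longrightarrow> wealth W\<^sub>0 X w t \<in> borel_measurable (F t)"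
proof (induction t)
  case 0
  have "wealth W\<^sub>0 X w 0 = (\<lambda>_. W\<^sub>0)" by auto
  then show ?case by simp
next
  case (Suc t)
  have [measurable]: "wealth W\<^sub>0 X w t \<in> borel_measurable (F (Suc t))"
    by (rule measurable_F_mono[of t]) (use Suc in auto)
  have [measurable]: "w t \<in> borel_measurable (F (Suc t))"
    by (rule measurable_F_mono[of t]) (use assms Suc.prems in \<open>auto simp: trading_strategy_def\<close>)
  have [measurable]: "X (Suc t) \<in> borel_measurable (F (Suc t))" by (rule adapted[OF Suc.prems])
  have "wealth W\<^sub>0 X w (Suc t) = (\<lambda>\<omega>. wealth W\<^sub>0 X w t \<omega> * (1 + w t \<omega> \<bullet> X (Suc t) \<omega>))" by auto
  then show ?case by simp
qed

lemma measurable_wealth: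
  "trading_strategy M F T w \<Longrightarrow> t \<le> T \<Longrightarrow> wealth W\<^sub>0 X w t \<in> borel_measurable M"
  using wealth_adapted measurable_from_F by blast

lemma integrable_utility_wealth_iff:
  assumes "\<alpha> > 0" "trading_strategy M F T w"
  shows "integrable M (\<lambda>\<omega>. utility \<alpha> (wealth W\<^sub>0 X w T \<omega>)) \<longleftrightarrow>
    (\<integral>\<^sup>+\<omega>. ennreal ((wealth W\<^sub>0 X w T \<omega> - 1 / \<alpha>)\<^sup>2) \<partial>M) < \<infinity>"
  using assms(1) measurable_wealth[OF assms(2) order_refl] by (rule integrable_utility_iff)

section \<open>Decomposition of the expected loss\<close>

text \<open>Wealth and weights are known at time \<open>t\<close>, so they are frozen while the
  independent return is integrated out; \<open>second_moment_eq\<close> then splits the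
  result.\<close>

lemma one_period_loss:
  assumes t: "t < T" and W: "W \<in> borel_measurable (F t)" and v: "v \<in> borel_measurable (F t)"
    and v1: "\<And>\<omega>. \<omega> \<in> space M \<Longrightarrow> v \<omega> \<bullet> 1 = 1" and A: "A \<in> sets (F t)"
  shows "(\<integral>\<^sup>+\<omega>\<in>A. ennreal ((W \<omega> * (1 + v \<omega> \<bullet> X (Suc t) \<omega>) - target \<alpha> (Suc t))\<^sup>2) \<partial>M) =
    (\<integral>\<^sup>+\<omega>\<in>A. ennreal (loss_factor (\<Sigma> (Suc t)) (\<mu> (Suc t)) * (W \<omega> - target \<alpha> t)\<^sup>2
        + (fixed_loss \<alpha> t + extra_loss \<alpha> t (W \<omega>) (v \<omega>))) \<partial>M)"
proof -
  let ?b = "target \<alpha> (Suc t)" and ?S = "\<Sigma> (Suc t)" and ?m = "\<mu> (Suc t)"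
  \<comment> \<open>The indicator of \<open>A\<close> is put into both components. Outside
    \<open>A\<close> the integrand is then zero, and the integral over \<open>A\<close> becomes one
    over the whole space.\<close>
  define Z where "Z \<omega> = (indicator A \<omega> * (W \<omega> - ?b), (indicator A \<omega> * W \<omega>) *\<^sub>R v \<omega>)" for \<omega>
  note [measurable] = W v A
  have Z: "Z \<in> F t \<rightarrow>\<^sub>M borel \<Otimes>\<^sub>M borel" unfolding Z_def by measurable
  have T: "Suc t \<le> T" using t by simp
  define f :: "(real \<times> (real^'k)) \<times> (real^'k) \<Rightarrow> ennreal"
    where "f z = ennreal ((fst (fst z) + snd (fst z) \<bullet> snd z)\<^sup>2)" for z
  have f: "f \<in> borel_measurable ((borel \<Otimes>\<^sub>M borel) \<Otimes>\<^sub>M borel)"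
    unfolding f_def by measurable
  have ind: "indep_set (sets (F t)) {X (Suc t) -` B \<inter> space M | B. B \<in> sets borel}"
    using indep[of "Suc t"] T by simp
  have "(\<integral>\<^sup>+\<omega>\<in>A. ennreal ((W \<omega> * (1 + v \<omega> \<bullet> X (Suc t) \<omega>) - ?b)\<^sup>2) \<partial>M)
      = (\<integral>\<^sup>+\<omega>. f (Z \<omega>, X (Suc t) \<omega>) \<partial>M)"
    by (intro nn_integral_cong) (auto simp: f_def Z_def indicator_def algebra_simps)
  also have "\<dots> = (\<integral>\<^sup>+\<omega>. \<integral>\<^sup>+\<omega>'. f (Z \<omega>, X (Suc t) \<omega>') \<partial>M \<partial>M)"
    by (rule nn_integral_indep[OF subalg Z measurable_X[OF T] ind f])
  also have "\<dots> = (\<integral>\<^sup>+\<omega>. ennreal ((fst (Z \<omega>) + snd (Z \<omega>) \<bullet> ?m)\<^sup>2 + snd (Z \<omega>) \<bullet> (?S *v snd (Z \<omega>))) \<partial>M)"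
    unfolding f_def fst_conv snd_conv
    by (simp add: second_moment_affine[OF measurable_X[OF T] square_integrable[OF T]] mean[OF T] covariance[OF T])
  also have "\<dots> = (\<integral>\<^sup>+\<omega>\<in>A. ennreal (loss_factor ?S ?m * (W \<omega> - target \<alpha> t)\<^sup>2
        + (fixed_loss \<alpha> t + extra_loss \<alpha> t (W \<omega>) (v \<omega>))) \<partial>M)"
  proof (intro nn_integral_cong)
    fix \<omega> assume "\<omega> \<in> space M"
    then have "(W \<omega> *\<^sub>R v \<omega>) \<bullet> 1 = W \<omega>" by (simp add: v1)
    from second_moment_eq[OF pos_def[OF T] this, of ?b ?m]
    show "ennreal ((fst (Z \<omega>) + snd (Z \<omega>) \<bullet> ?m)\<^sup>2 + snd (Z \<omega>) \<bullet> (?S *v snd (Z \<omega>))) =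
      ennreal (loss_factor ?S ?m * (W \<omega> - target \<alpha> t)\<^sup>2
        + (fixed_loss \<alpha> t + extra_loss \<alpha> t (W \<omega>) (v \<omega>))) * indicator A \<omega>"
      by (simp add: Z_def target_Suc[OF t] fixed_loss_def extra_loss_def opt_invest_def indicator_def)
  qed
  finally show ?thesis .
qed

text \<open>Backward induction from \<open>T\<close> with \<open>one_period_loss\<close>, using that
  an event known at time \<open>n\<close> is known later. An exact identity, valid also for infinite
  losses, allows strategies with a common past to be compared term by term.\<close>

lemma terminal_loss:
  assumes w: "trading_strategy M F T w" and n: "n \<le> T"
  shows "A \<in> sets (F n) \<Longrightarrow> (\<integral>\<^sup>+\<omega>\<in>A. ennreal ((wealth W\<^sub>0 X w T \<omega> - 1 / \<alpha>)\<^sup>2) \<partial>M) =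
     ennreal (factor n) * (\<integral>\<^sup>+\<omega>\<in>A. ennreal ((wealth W\<^sub>0 X w n \<omega> - target \<alpha> n)\<^sup>2) \<partial>M)
     + (\<Sum>t\<in>{n..<T}. ennreal (factor (Suc t)) *
         (\<integral>\<^sup>+\<omega>\<in>A. (ennreal (fixed_loss \<alpha> t) + ennreal (extra_loss \<alpha> t (wealth W\<^sub>0 X w t \<omega>) (w t \<omega>))) \<partial>M))"
  using n
proof (induction n rule: inc_induct)
  case base
  then show ?case by (simp add: factor_T target_T)
next
  case (step n)
  let ?W = "wealth W\<^sub>0 X w" and ?L = "loss_factor (\<Sigma> (Suc n)) (\<mu> (Suc n))"
  let ?f = "\<lambda>\<omega>. ennreal (fixed_loss \<alpha> n) + ennreal (extra_loss \<alpha> n (?W n \<omega>) (w n \<omega>))"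
  have n: "n < T" by fact
  have L: "0 \<le> ?L" using loss_factor_pos[OF pos_def, of "Suc n"] n by (simp add: less_imp_le)
  have A': "A \<in> sets (F (Suc n))" using step.prems sets_F_mono[of n "Suc n"] by auto
  have WF: "?W n \<in> borel_measurable (F n)" by (rule wealth_adapted[OF w]) (use n in simp)
  have wF: "w n \<in> borel_measurable (F n)" using w n by (simp add: trading_strategy_def)
  have [measurable]: "A \<in> events" by (rule sets_F_events[OF step.prems])
  have [measurable]: "?W n \<in> borel_measurable M" "w n \<in> borel_measurable M"
    using WF wF by (auto intro: measurable_from_F)
  have fm: "(\<lambda>\<omega>. ?f \<omega> * indicator A \<omega>) \<in> borel_measurable M"
    unfolding extra_loss_def by measurable
  have "(\<integral>\<^sup>+\<omega>\<in>A. ennreal ((?W (Suc n) \<omega> - target \<alpha> (Suc n))\<^sup>2) \<partial>M) =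
      (\<integral>\<^sup>+\<omega>\<in>A. ennreal (?L * (?W n \<omega> - target \<alpha> n)\<^sup>2
        + (fixed_loss \<alpha> n + extra_loss \<alpha> n (?W n \<omega>) (w n \<omega>))) \<partial>M)"
    using one_period_loss[OF n WF wF _ step.prems, of \<alpha>] w n by (simp add: trading_strategy_def)
  also have "\<dots> = (\<integral>\<^sup>+\<omega>. ennreal ?L * (ennreal ((?W n \<omega> - target \<alpha> n)\<^sup>2) * indicator A \<omega>) + ?f \<omega> * indicator A \<omega> \<partial>M)"
    by (intro nn_integral_cong)
      (simp add: indicator_def ennreal_plus ennreal_mult L fixed_loss_nonneg[OF n] extra_loss_nonneg[OF n])
  also have "\<dots> = ennreal ?L * (\<integral>\<^sup>+\<omega>\<in>A. ennreal ((?W n \<omega> - target \<alpha> n)\<^sup>2) \<partial>M) + (\<integral>\<^sup>+\<omega>\<in>A. ?f \<omega> \<partial>M)"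
    by (subst nn_integral_add) (simp_all add: fm nn_integral_cmult)
  finally have eq: "(\<integral>\<^sup>+\<omega>\<in>A. ennreal ((?W (Suc n) \<omega> - target \<alpha> (Suc n))\<^sup>2) \<partial>M) = \<dots>" .
  have sum: "(\<Sum>t\<in>{n..<T}. g t) = g n + (\<Sum>t\<in>{Suc n..<T}. g t)" for g :: "nat \<Rightarrow> ennreal"
    using n by (rule sum.atLeast_Suc_lessThan)
  show ?case
    unfolding step.IH[OF A'] eq sum factor_Suc[OF n]
    using factor_pos[of "Suc n"] L by (simp add: ennreal_mult distrib_left mult.assoc add.assoc)
qed

section \<open>Sufficiency of the weights\<close>

text \<open>On each event of \<open>F n\<close>, a competitor has the same first term in
  \<open>terminal_loss\<close> and pays at least the fixed losses, whereas \<open>w\<close> pays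
  exactly these. Wealth must be nonzero because the extra loss at zero wealth is in general
  positive, whatever the weights.\<close>

lemma optimal_from_if_optimal_weights:
  assumes \<alpha>: "\<alpha> > 0" and w: "trading_strategy M F T w" and n: "n \<le> T"
    and sq: "integrable M (\<lambda>\<omega>. (wealth W\<^sub>0 X w n \<omega>)\<^sup>2)"
    and opt: "\<And>r. n \<le> r \<Longrightarrow> r < T \<Longrightarrow> AE \<omega> in M. wealth W\<^sub>0 X w r \<omega> \<noteq> 0 \<and>
       w r \<omega> = optimal_weights \<alpha> \<mu> \<Sigma> T (r + 1) (wealth W\<^sub>0 X w r \<omega>)"
  shows "optimal_from M F X T \<alpha> W\<^sub>0 n w"
proof -
  let ?W = "wealth W\<^sub>0 X w"
  let ?E = "\<lambda>A v t. (\<integral>\<^sup>+\<omega>\<in>A. (ennreal (fixed_loss \<alpha> t) + ennreal (extra_loss \<alpha> t (wealth W\<^sub>0 X v t \<omega>) (v t \<omega>))) \<partial>M)"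
  have opt0: "?E A w t = ennreal (fixed_loss \<alpha> t) * emeasure M A" if "n \<le> t" "t < T" "A \<in> events" for A t
  proof -
    have "?E A w t = (\<integral>\<^sup>+\<omega>\<in>A. ennreal (fixed_loss \<alpha> t) \<partial>M)"
      by (intro nn_integral_cong_AE, use opt[OF that(1,2)] in eventually_elim)
        (simp add: extra_loss_eq_0_iff[OF that(2), THEN iffD2])
    then show ?thesis using that(3) by (simp add: nn_integral_cmult_indicator)
  qed
  \<comment> \<open>Square integrability at time \<open>n\<close> makes the first term finite and
    thereby \<open>w\<close> admissible.\<close>
  have fin: "(\<integral>\<^sup>+\<omega>\<in>space M. ennreal ((?W T \<omega> - 1 / \<alpha>)\<^sup>2) \<partial>M) < \<infinity>"
  proof -
    have "integrable M (?W n)"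
      by (rule square_integrable_imp_integrable[OF measurable_wealth[OF w n] sq])
    then have "integrable M (\<lambda>\<omega>. (?W n \<omega> - target \<alpha> n)\<^sup>2)"
      using sq by (simp add: power2_diff)
    then have "(\<integral>\<^sup>+\<omega>. ennreal ((?W n \<omega> - target \<alpha> n)\<^sup>2) \<partial>M) < \<infinity>"
      by (simp add: integrable_iff_bounded)
    then have "(\<integral>\<^sup>+\<omega>\<in>space M. ennreal ((?W n \<omega> - target \<alpha> n)\<^sup>2) \<partial>M) < \<infinity>"
      by (simp cong: nn_integral_cong)
    moreover have "space M \<in> sets (F n)" using space_F[of n] sets.top[of "F n"] by simp
    moreover have "ennreal (factor (Suc t)) * ?E (space M) w t < \<infinity>" if "t \<in> {n..<T}" for t
      using that by (subst opt0) (auto simp: ennreal_mult_less_top emeasure_eq_measure)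
    ultimately show ?thesis
      by (subst terminal_loss[OF w n]) (auto simp: ennreal_mult_less_top)
  qed
  have adm: "admissible M F X T \<alpha> W\<^sub>0 w"
    using w fin integrable_utility_wealth_iff[OF \<alpha> w] by (simp add: admissible_def cong: nn_integral_cong)
  show ?thesis
    unfolding optimal_from_def
  proof (intro conjI adm allI impI)
    fix w' assume w': "admissible M F X T \<alpha> W\<^sub>0 w' \<and> (\<forall>s<n. \<forall>\<omega>\<in>space M. w' s \<omega> = w s \<omega>)"
    let ?W' = "wealth W\<^sub>0 X w'"
    have tw': "trading_strategy M F T w'" and iu': "integrable M (\<lambda>\<omega>. utility \<alpha> (?W' T \<omega>))"
      using w' by (auto simp: admissible_def)
    have iu: "integrable M (\<lambda>\<omega>. utility \<alpha> (?W T \<omega>))" using adm by (simp add: admissible_def)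
    have int: "integrable M (\<lambda>\<omega>. (wealth W\<^sub>0 X v T \<omega> - 1 / \<alpha>)\<^sup>2)"
      if "trading_strategy M F T v" "integrable M (\<lambda>\<omega>. utility \<alpha> (wealth W\<^sub>0 X v T \<omega>))" for v
      using that integrable_utility_wealth_iff[OF \<alpha>, of v W\<^sub>0] measurable_wealth[of v T W\<^sub>0] by (simp add: integrable_iff_bounded)
    show "AE \<omega> in M. real_cond_exp M (F n) (\<lambda>\<omega>. utility \<alpha> (?W' T \<omega>)) \<omega>
                  \<le> real_cond_exp M (F n) (\<lambda>\<omega>. utility \<alpha> (?W T \<omega>)) \<omega>"
    proof (rule real_cond_exp_le[OF subalg iu' iu])
      fix A assume A: "A \<in> sets (F n)"
      have Am: "A \<in> events" by (rule sets_F_events[OF A])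
      have "(\<integral>\<^sup>+\<omega>\<in>A. ennreal ((?W T \<omega> - 1 / \<alpha>)\<^sup>2) \<partial>M) \<le> (\<integral>\<^sup>+\<omega>\<in>A. ennreal ((?W' T \<omega> - 1 / \<alpha>)\<^sup>2) \<partial>M)"
        unfolding terminal_loss[OF w n A] terminal_loss[OF tw' n A]
      proof (intro add_mono mult_left_mono sum_mono)
        have "?W n \<omega> = ?W' n \<omega>" if "\<omega> \<in> space M" for \<omega>
          using w' that by (intro wealth_cong) auto
        then show "(\<integral>\<^sup>+\<omega>\<in>A. ennreal ((?W n \<omega> - target \<alpha> n)\<^sup>2) \<partial>M) \<le> (\<integral>\<^sup>+\<omega>\<in>A. ennreal ((?W' n \<omega> - target \<alpha> n)\<^sup>2) \<partial>M)"
          by (intro nn_integral_mono) simp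
      next
        fix t assume t: "t \<in> {n..<T}"
        then have "?E A w t = (\<integral>\<^sup>+\<omega>\<in>A. ennreal (fixed_loss \<alpha> t) \<partial>M)"
          using opt0[of t A] Am by (simp add: nn_integral_cmult_indicator)
        also have "\<dots> \<le> ?E A w' t"
          by (intro nn_integral_mono mult_right_mono) simp_all
        finally show "?E A w t \<le> ?E A w' t" .
      qed simp_all
      then have "(\<integral>\<omega>\<in>A. (?W T \<omega> - 1 / \<alpha>)\<^sup>2 \<partial>M) \<le> (\<integral>\<omega>\<in>A. (?W' T \<omega> - 1 / \<alpha>)\<^sup>2 \<partial>M)"
        by (intro set_integral_mono_nn_integral int w tw' iu iu' Am) auto
      moreover have "(\<integral>\<omega>\<in>A. utility \<alpha> (wealth W\<^sub>0 X v T \<omega>) \<partial>M) =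
          prob A / (2 * \<alpha>) - \<alpha> / 2 * (\<integral>\<omega>\<in>A. (wealth W\<^sub>0 X v T \<omega> - 1 / \<alpha>)\<^sup>2 \<partial>M)"
        if "integrable M (\<lambda>\<omega>. (wealth W\<^sub>0 X v T \<omega> - 1 / \<alpha>)\<^sup>2)" for v
      proof -
        have "set_integrable M A (\<lambda>\<omega>. \<alpha> / 2 * (wealth W\<^sub>0 X v T \<omega> - 1 / \<alpha>)\<^sup>2)"
          unfolding set_integrable_def using that Am by (intro integrable_mult_indicator) auto
        moreover have "set_integrable M A (\<lambda>\<omega>. 1 / (2 * \<alpha>))"
          unfolding set_integrable_def using Am by (intro integrable_mult_indicator) auto
        ultimately show ?thesis
          unfolding utility_eq[OF \<alpha>] using Am by (subst set_integral_diff) (simp_all add: set_lebesgue_integral_def)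
      qed
      ultimately show "(\<integral>\<omega>\<in>A. utility \<alpha> (?W' T \<omega>) \<partial>M) \<le> (\<integral>\<omega>\<in>A. utility \<alpha> (?W T \<omega>) \<partial>M)"
        using \<alpha> int[OF w iu] int[OF tw' iu'] by simp
    qed
  qed
qed

section \<open>Perturbed competitors and necessity of the weights\<close>

text \<open>The decisions at times \<open>n, ..., j - 1\<close> are replaced one after the other by
  the optimal amount plus a small generic zero-cost shift. Each replacement leaves earlier wealth
  unchanged, so the properties already obtained persist.\<close>

lemma near_optimal_competitor:
  assumes w: "trading_strategy M F T w" and n: "n \<le> T" and \<delta>: "\<delta> > 0"
  shows "j \<le> T \<Longrightarrow> n \<le> j \<Longrightarrow> \<exists>w'. trading_strategy M F T w' \<and> (\<forall>s<n. \<forall>\<omega>. w' s \<omega> = w s \<omega>) \<and>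
    (\<forall>r. n \<le> r \<longrightarrow> r < j \<longrightarrow> (AE \<omega> in M.
       (wealth W\<^sub>0 X w' r \<omega> \<noteq> 0 \<longrightarrow> extra_loss \<alpha> r (wealth W\<^sub>0 X w' r \<omega>) (w' r \<omega>) \<le> \<delta>) \<and>
       (wealth W\<^sub>0 X w' (Suc r) \<omega> = 0 \<longrightarrow> wealth W\<^sub>0 X w' r \<omega> = 0 \<or> X (Suc r) \<omega> = (-1) *\<^sub>R 1)))"
proof (induction j)
  case 0
  then show ?case using w by (intro exI[of _ w]) simp
next
  case (Suc j)
  show ?case
  proof (cases "n = Suc j")
    case True
    then show ?thesis using w by (intro exI[of _ w]) simp
  next
    case False
    with Suc.prems have "n \<le> j" "j < T" by auto
    with Suc.IH obtain w' where w': "trading_strategy M F T w'" and ag: "\<And>s \<omega>. s < n \<Longrightarrow> w' s \<omega> = w s \<omega>"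
      and IH: "\<And>r. n \<le> r \<Longrightarrow> r < j \<Longrightarrow> AE \<omega> in M.
       (wealth W\<^sub>0 X w' r \<omega> \<noteq> 0 \<longrightarrow> extra_loss \<alpha> r (wealth W\<^sub>0 X w' r \<omega>) (w' r \<omega>) \<le> \<delta>) \<and>
       (wealth W\<^sub>0 X w' (Suc r) \<omega> = 0 \<longrightarrow> wealth W\<^sub>0 X w' r \<omega> = 0 \<or> X (Suc r) \<omega> = (-1) *\<^sub>R 1)"
      by auto
    let ?W = "wealth W\<^sub>0 X w' j" and ?e = "excess_loss (\<Sigma> (Suc j)) (\<mu> (Suc j))"
    have WF: "?W \<in> borel_measurable (F j)" using wealth_adapted[OF w'] \<open>j < T\<close> by simp
    note [measurable] = measurable_from_F[OF WF]
    have [measurable]: "X (Suc j) \<in> borel_measurable M" using \<open>j < T\<close> by simp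
    \<comment> \<open>Where the wealth is nonzero, the deviation from the optimal amount will be
      exactly \<open>u\<close>, so continuity at \<open>0\<close> bounds its cost by
      \<open>\<delta>\<close>.\<close>
    have "isCont ?e 0" using continuous_on_excess_loss[of "\<Sigma> (Suc j)" "\<mu> (Suc j)"] by (simp add: continuous_on_eq_continuous_at)
    then obtain \<epsilon> where \<epsilon>: "\<epsilon> > 0" and near: "\<And>u. dist u 0 < \<epsilon> \<Longrightarrow> dist (?e u) (?e 0) < \<delta>"
      using \<delta> unfolding continuous_at_eps_delta by blast
    have small: "?e u \<le> \<delta>" if "norm u < \<epsilon>" for u
      using near[of u] that excess_loss_eq_0_iff[OF pos_def[of "Suc j"], of "\<mu> (Suc j)" 0] \<open>j < T\<close>
      by (simp add: dist_real_def)
    obtain u where u: "u \<bullet> 1 = 0" "norm u < \<epsilon>"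
      and gen: "AE \<omega> in M. X (Suc j) \<omega> \<notin> range (\<lambda>c. c *\<^sub>R 1) \<longrightarrow>
        (?W \<omega> + opt_invest \<alpha> j (?W \<omega>) \<bullet> X (Suc j) \<omega>) + u \<bullet> X (Suc j) \<omega> \<noteq> 0"
      using exists_generic_shift[of "X (Suc j)" "\<lambda>\<omega>. ?W \<omega> + opt_invest \<alpha> j (?W \<omega>) \<bullet> X (Suc j) \<omega>", OF _ _ \<epsilon>]
      by auto
    \<comment> \<open>At zero wealth no amount can be invested; keeping the old weights preserves
      measurability and the budget constraint.\<close>
    define v where "v \<omega> = (if ?W \<omega> = 0 then w' j \<omega> else (1 / ?W \<omega>) *\<^sub>R (opt_invest \<alpha> j (?W \<omega>) + u))" for \<omega>
    define w'' where "w'' = w'(j := v)"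
    have "v \<in> borel_measurable (F j)"
      unfolding v_def using w' WF \<open>j < T\<close> by (auto simp: trading_strategy_def)
    moreover have v1: "v \<omega> \<bullet> 1 = 1" if "\<omega> \<in> space M" for \<omega>
      using w' that u \<open>j < T\<close> by (auto simp: v_def inner_add_left opt_invest_inner_one trading_strategy_def)
    ultimately have tw'': "trading_strategy M F T w''"
      using w' by (auto simp: trading_strategy_def w''_def)
    have same: "wealth W\<^sub>0 X w'' r \<omega> = wealth W\<^sub>0 X w' r \<omega>" if "r \<le> j" for r \<omega>
      using that by (intro wealth_cong) (simp add: w''_def)
    have new: "wealth W\<^sub>0 X w'' (Suc j) \<omega> = ?W \<omega> * (1 + v \<omega> \<bullet> X (Suc j) \<omega>)" for \<omega>
      by (simp add: same) (simp add: w''_def)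
    have W0: "?W \<omega> = 0 \<or> X (Suc j) \<omega> = (-1) *\<^sub>R 1"
      if sp: "\<omega> \<in> space M" and z: "?W \<omega> * (1 + v \<omega> \<bullet> X (Suc j) \<omega>) = 0"
        and g: "X (Suc j) \<omega> \<notin> range (\<lambda>c. c *\<^sub>R 1) \<longrightarrow>
        (?W \<omega> + opt_invest \<alpha> j (?W \<omega>) \<bullet> X (Suc j) \<omega>) + u \<bullet> X (Suc j) \<omega> \<noteq> 0" for \<omega>
    proof (cases "?W \<omega> = 0")
      case False
      then have "(?W \<omega> + opt_invest \<alpha> j (?W \<omega>) \<bullet> X (Suc j) \<omega>) + u \<bullet> X (Suc j) \<omega> = ?W \<omega> * (1 + v \<omega> \<bullet> X (Suc j) \<omega>)"
        by (simp add: v_def distrib_left inner_add_left)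
      with z g obtain c where c: "X (Suc j) \<omega> = c *\<^sub>R 1" by auto
      \<comment> \<open>If all assets return the same \<open>c\<close>, every fully invested
        portfolio returns \<open>c\<close>; ruin then means \<open>c = -1\<close>.\<close>
      then have "1 + c = 0" using z False v1[OF sp] by simp
      then have "c = -1" by simp
      with c show ?thesis by simp
    qed simp
    have ex: "?W \<omega> \<noteq> 0 \<Longrightarrow> extra_loss \<alpha> j (?W \<omega>) (v \<omega>) \<le> \<delta>" for \<omega>
      using small[OF u(2)] by (simp add: extra_loss_def v_def)
    show ?thesis
    proof (intro exI[of _ w''] conjI tw'' allI impI)
      fix s \<omega> assume "s < n" then show "w'' s \<omega> = w s \<omega>" using ag \<open>n \<le> j\<close> by (simp add: w''_def)
    next
      fix r assume "n \<le> r" "r < Suc j"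
      show "AE \<omega> in M.
       (wealth W\<^sub>0 X w'' r \<omega> \<noteq> 0 \<longrightarrow> extra_loss \<alpha> r (wealth W\<^sub>0 X w'' r \<omega>) (w'' r \<omega>) \<le> \<delta>) \<and>
       (wealth W\<^sub>0 X w'' (Suc r) \<omega> = 0 \<longrightarrow> wealth W\<^sub>0 X w'' r \<omega> = 0 \<or> X (Suc r) \<omega> = (-1) *\<^sub>R 1)"
      proof (cases "r = j")
        case True
        have "w'' j = v" by (simp add: w''_def)
        show ?thesis unfolding True new same[OF order_refl] \<open>w'' j = v\<close>
          using gen AE_space by eventually_elim (use ex W0 in blast)
      next
        case False
        with \<open>r < Suc j\<close> have r: "r < j" by simp
        have s1: "wealth W\<^sub>0 X w'' (Suc r) \<omega> = wealth W\<^sub>0 X w' (Suc r) \<omega>"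
          "wealth W\<^sub>0 X w'' r \<omega> = wealth W\<^sub>0 X w' r \<omega>" "w'' r \<omega> = w' r \<omega>" for \<omega>
          using r same[of "Suc r"] same[of r] by (simp_all add: w''_def del: wealth.simps)
        show ?thesis unfolding s1 using IH[OF \<open>n \<le> r\<close> r] .
      qed
    qed
  qed
qed

text \<open>Optimality bounds the loss of \<open>w\<close> by that of a competitor whose extra cost,
  beyond what \<open>w\<close> itself cannot avoid, is of order \<open>\<delta>\<close>. Letting
  \<open>\<delta>\<close> tend to zero, the avoidable extra loss of \<open>w\<close> has expectation
  zero.\<close>

lemma optimal_weights_if_optimal_from:
  assumes \<alpha>: "\<alpha> > 0" and n: "n \<le> T" and opt: "optimal_from M F X T \<alpha> W\<^sub>0 n w"
    and r: "n \<le> r" "r < T"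
  shows "AE \<omega> in M. wealth W\<^sub>0 X w r \<omega> \<noteq> 0 \<longrightarrow>
    w r \<omega> = optimal_weights \<alpha> \<mu> \<Sigma> T (r + 1) (wealth W\<^sub>0 X w r \<omega>)"
proof -
  let ?W = "wealth W\<^sub>0 X w"
  have w: "trading_strategy M F T w" and iu: "integrable M (\<lambda>\<omega>. utility \<alpha> (?W T \<omega>))"
    using opt by (auto simp: optimal_from_def admissible_def)
  define B where "B = ennreal (factor n) * (\<integral>\<^sup>+\<omega>. ennreal ((?W n \<omega> - target \<alpha> n)\<^sup>2) \<partial>M)"
  define E where "E v t = (\<integral>\<^sup>+\<omega>. (ennreal (fixed_loss \<alpha> t) + ennreal (extra_loss \<alpha> t (wealth W\<^sub>0 X v t \<omega>) (v t \<omega>))) \<partial>M)" for v t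
  have loss: "(\<integral>\<^sup>+\<omega>. ennreal ((wealth W\<^sub>0 X v T \<omega> - 1 / \<alpha>)\<^sup>2) \<partial>M) = B + (\<Sum>t\<in>{n..<T}. ennreal (factor (Suc t)) * E v t)"
    if "trading_strategy M F T v" "\<And>s \<omega>. s < n \<Longrightarrow> v s \<omega> = w s \<omega>" for v
  proof -
    have "space M \<in> sets (F n)" using space_F[of n] sets.top[of "F n"] by simp
    moreover have "wealth W\<^sub>0 X v n \<omega> = ?W n \<omega>" for \<omega> using that(2) by (rule wealth_cong)
    ultimately show ?thesis
      using terminal_loss[OF that(1) n, of "space M" W\<^sub>0 \<alpha>] by (simp add: B_def E_def cong: nn_integral_cong)
  qed
  have B: "B < \<infinity>"
    using iu unfolding integrable_utility_wealth_iff[OF \<alpha> w] loss[OF w refl] by (simp add: less_top)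
  text \<open>At zero wealth the loss no longer depends on the weights.\<close>
  define c where "c t = extra_loss \<alpha> t 0 0" for t
  have c: "extra_loss \<alpha> t 0 v = c t" for t v by (simp add: c_def extra_loss_def)
  let ?I = "\<lambda>t \<omega>. indicator {0} (?W t \<omega>) :: ennreal"
  \<comment> \<open>\<open>G\<close> collects the fixed loss and the cost of being at zero wealth;
    \<open>D\<close> is the extra loss that \<open>w\<close> incurs at nonzero wealth.\<close>
  define G where "G t = (\<integral>\<^sup>+\<omega>. ennreal (fixed_loss \<alpha> t) + ennreal (c t) * ?I t \<omega> \<partial>M)" for t
  define D where "D t = (\<integral>\<^sup>+\<omega>. ennreal (extra_loss \<alpha> t (?W t \<omega>) (w t \<omega>)) * indicator (-{0}) (?W t \<omega>) \<partial>M)" for t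
  have mw: "w t \<in> borel_measurable M" if "t < T" for t
    by (rule measurable_from_F[of _ t]) (use w that in \<open>simp add: trading_strategy_def\<close>)
  have Ew: "E w t = D t + G t" if "t < T" for t
  proof -
    have [measurable]: "?W t \<in> borel_measurable M" using measurable_wealth[OF w] that by simp
    note [measurable] = mw[OF that]
    have "E w t = (\<integral>\<^sup>+\<omega>. ennreal (extra_loss \<alpha> t (?W t \<omega>) (w t \<omega>)) * indicator (-{0}) (?W t \<omega>)
        + (ennreal (fixed_loss \<alpha> t) + ennreal (c t) * ?I t \<omega>) \<partial>M)"
      unfolding E_def by (intro nn_integral_cong) (auto simp: indicator_def c)
    also have "\<dots> = D t + G t"
      unfolding D_def G_def by (rule nn_integral_add) (unfold extra_loss_def, measurable)
    finally show ?thesis .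
  qed
  have Gfin: "G t < \<infinity>" if "t < T" for t
  proof -
    have "G t \<le> (\<integral>\<^sup>+\<omega>. ennreal (fixed_loss \<alpha> t) + ennreal (c t) \<partial>M)"
      unfolding G_def by (intro nn_integral_mono) (auto simp: indicator_def)
    also have "\<dots> < \<infinity>" by (simp add: emeasure_space_1 less_top[symmetric])
    finally show ?thesis .
  qed
  let ?q = "\<lambda>t. ennreal (factor (Suc t))"
  have key: "(\<Sum>t\<in>{n..<T}. ?q t * D t) \<le> (\<Sum>t\<in>{n..<T}. ?q t) * ennreal \<delta>" if \<delta>: "\<delta> > 0" for \<delta>
  proof -
    obtain w' where w': "trading_strategy M F T w'" and ag: "\<And>s \<omega>. s < n \<Longrightarrow> w' s \<omega> = w s \<omega>"
      and near: "\<And>r. n \<le> r \<Longrightarrow> r < T \<Longrightarrow> AE \<omega> in M.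
       (wealth W\<^sub>0 X w' r \<omega> \<noteq> 0 \<longrightarrow> extra_loss \<alpha> r (wealth W\<^sub>0 X w' r \<omega>) (w' r \<omega>) \<le> \<delta>) \<and>
       (wealth W\<^sub>0 X w' (Suc r) \<omega> = 0 \<longrightarrow> wealth W\<^sub>0 X w' r \<omega> = 0 \<or> X (Suc r) \<omega> = (-1) *\<^sub>R 1)"
      using near_optimal_competitor[OF w n \<delta> order_refl n, of W\<^sub>0 \<alpha>] by (elim exE conjE) (simp add: that)
    let ?W' = "wealth W\<^sub>0 X w'"
    \<comment> \<open>The competitor is newly ruined only when all assets lose everything, and
      \<open>w\<close>, being fully invested, is then ruined too.\<close>
    have zero: "r \<le> T \<Longrightarrow> AE \<omega> in M. ?W' r \<omega> = 0 \<longrightarrow> ?W r \<omega> = 0" if "n \<le> r" for r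
      using that
    proof (induction r rule: dec_induct)
      case base
      have "?W' n \<omega> = ?W n \<omega>" for \<omega> using ag by (rule wealth_cong)
      then show ?case by simp
    next
      case (step r)
      then have "AE \<omega> in M. ?W' r \<omega> = 0 \<longrightarrow> ?W r \<omega> = 0" "r < T" by auto
      with near[OF step.hyps(1) \<open>r < T\<close>] AE_space show ?case
      proof eventually_elim
        case (elim \<omega>)
        have "w r \<omega> \<bullet> 1 = 1" using w \<open>r < T\<close> elim by (auto simp: trading_strategy_def)
        with elim show ?case by auto
      qed
    qed
    \<comment> \<open>Ruin of the competitor thus costs no more than the ruin of \<open>w\<close>
      already counted in \<open>G\<close>.\<close>
    have Ew': "E w' t \<le> ennreal \<delta> + G t" if t: "n \<le> t" "t < T" for t
    proof -
      have [measurable]: "?W t \<in> borel_measurable M" using measurable_wealth[OF w] t by simp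
      have "AE \<omega> in M. ennreal (extra_loss \<alpha> t (?W' t \<omega>) (w' t \<omega>)) \<le> ennreal \<delta> + ennreal (c t) * ?I t \<omega>"
        using near[OF t] zero[OF t(1) less_imp_le[OF t(2)]]
      proof eventually_elim
        case (elim \<omega>)
        show ?case
        proof (cases "?W' t \<omega> = 0")
          case True
          with elim show ?thesis by (simp add: c)
        next
          case False
          with elim have "ennreal (extra_loss \<alpha> t (?W' t \<omega>) (w' t \<omega>)) \<le> ennreal \<delta>" by (intro ennreal_leI) auto
          then show ?thesis by (rule order_trans) simp
        qed
      qed
      then have "AE \<omega> in M. ennreal (fixed_loss \<alpha> t) + ennreal (extra_loss \<alpha> t (?W' t \<omega>) (w' t \<omega>))
          \<le> ennreal \<delta> + (ennreal (fixed_loss \<alpha> t) + ennreal (c t) * ?I t \<omega>)"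
      proof eventually_elim
        case (elim \<omega>)
        then show ?case by (simp only: add.left_commute[of "ennreal \<delta>"] add_left_mono)
      qed
      then have "E w' t \<le> (\<integral>\<^sup>+\<omega>. ennreal \<delta> + (ennreal (fixed_loss \<alpha> t) + ennreal (c t) * ?I t \<omega>) \<partial>M)"
        unfolding E_def by (rule nn_integral_mono_AE)
      also have "\<dots> = ennreal \<delta> + G t"
        unfolding G_def by (subst nn_integral_add) (simp_all add: emeasure_space_1)
      finally show ?thesis .
    qed
    have le': "(\<Sum>t\<in>{n..<T}. ?q t * E w' t) \<le> (\<Sum>t\<in>{n..<T}. ?q t) * ennreal \<delta> + (\<Sum>t\<in>{n..<T}. ?q t * G t)"
      unfolding sum_distrib_right sum.distrib[symmetric] distrib_left[symmetric]
      using Ew' by (intro sum_mono mult_left_mono) auto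
    have sG: "(\<Sum>t\<in>{n..<T}. ?q t * G t) < \<infinity>"
      using Gfin by (auto simp: ennreal_mult_less_top)
    have loss': "(\<integral>\<^sup>+\<omega>. ennreal ((?W' T \<omega> - 1 / \<alpha>)\<^sup>2) \<partial>M) = B + (\<Sum>t\<in>{n..<T}. ?q t * E w' t)"
      by (rule loss[OF w' ag])
    \<comment> \<open>Optimality speaks about admissible competitors only, so finiteness of the loss
      comes first.\<close>
    have "(\<Sum>t\<in>{n..<T}. ?q t * E w' t) < \<infinity>"
      using sG by (intro le_less_trans[OF le']) (simp add: ennreal_mult_less_top)
    then have iu': "integrable M (\<lambda>\<omega>. utility \<alpha> (?W' T \<omega>))"
      using B unfolding integrable_utility_wealth_iff[OF \<alpha> w'] loss' by simp
    have "AE \<omega> in M. real_cond_exp M (F n) (\<lambda>\<omega>. utility \<alpha> (?W' T \<omega>)) \<omega>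
                  \<le> real_cond_exp M (F n) (\<lambda>\<omega>. utility \<alpha> (?W T \<omega>)) \<omega>"
      using opt w' iu' ag by (auto simp: optimal_from_def admissible_def)
    moreover
    interpret Fn: finite_measure_subalgebra M "F n" using subalg by unfold_locales
    interpret Fn: sigma_finite_subalgebra M "F n" using Fn.finite_measure_subalgebra_axioms
      by (rule finite_measure_subalgebra_is_sigma_finite)
    \<comment> \<open>Taking expectations of the conditional inequality suffices, since the losses
      are compared on the whole space.\<close>
    have "(\<integral>\<omega>. utility \<alpha> (?W' T \<omega>) \<partial>M) \<le> (\<integral>\<omega>. utility \<alpha> (?W T \<omega>) \<partial>M)"
      if "AE \<omega> in M. real_cond_exp M (F n) (\<lambda>\<omega>. utility \<alpha> (?W' T \<omega>)) \<omega>
                  \<le> real_cond_exp M (F n) (\<lambda>\<omega>. utility \<alpha> (?W T \<omega>)) \<omega>"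
      unfolding Fn.real_cond_exp_int(2)[OF iu, symmetric] Fn.real_cond_exp_int(2)[OF iu', symmetric]
      by (intro integral_mono_AE Fn.real_cond_exp_int iu iu' that)
    ultimately have "(\<integral>\<omega>. utility \<alpha> (?W' T \<omega>) \<partial>M) \<le> (\<integral>\<omega>. utility \<alpha> (?W T \<omega>) \<partial>M)" by blast
    moreover have i: "integrable M (\<lambda>\<omega>. (wealth W\<^sub>0 X v T \<omega> - 1 / \<alpha>)\<^sup>2)"
      if "trading_strategy M F T v" "integrable M (\<lambda>\<omega>. utility \<alpha> (wealth W\<^sub>0 X v T \<omega>))" for v
      using that integrable_utility_wealth_iff[OF \<alpha>, of v W\<^sub>0] measurable_wealth[of v T W\<^sub>0] by (simp add: integrable_iff_bounded)
    ultimately have "(\<integral>\<omega>. (?W T \<omega> - 1 / \<alpha>)\<^sup>2 \<partial>M) \<le> (\<integral>\<omega>. (?W' T \<omega> - 1 / \<alpha>)\<^sup>2 \<partial>M)"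
      using \<alpha> i[OF w iu] i[OF w' iu'] by (simp add: utility_eq)
    then have "(\<integral>\<^sup>+\<omega>. ennreal ((?W T \<omega> - 1 / \<alpha>)\<^sup>2) \<partial>M) \<le> (\<integral>\<^sup>+\<omega>. ennreal ((?W' T \<omega> - 1 / \<alpha>)\<^sup>2) \<partial>M)"
      using i[OF w iu] i[OF w' iu'] by (simp add: nn_integral_eq_integral ennreal_leI)
    then have "(\<Sum>t\<in>{n..<T}. ?q t * E w t) \<le> (\<Sum>t\<in>{n..<T}. ?q t * E w' t)"
      unfolding loss[OF w refl] loss' using B by (auto simp: ennreal_add_left_cancel_le)
    moreover have "(\<Sum>t\<in>{n..<T}. ?q t * E w t) = (\<Sum>t\<in>{n..<T}. ?q t * G t) + (\<Sum>t\<in>{n..<T}. ?q t * D t)"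
      unfolding sum.distrib[symmetric] distrib_left[symmetric] by (intro sum.cong) (simp_all add: Ew add.commute)
    ultimately have "(\<Sum>t\<in>{n..<T}. ?q t * G t) + (\<Sum>t\<in>{n..<T}. ?q t * D t)
        \<le> (\<Sum>t\<in>{n..<T}. ?q t * G t) + (\<Sum>t\<in>{n..<T}. ?q t) * ennreal \<delta>"
      using le' by (simp only: add.commute[of "(\<Sum>t\<in>{n..<T}. ?q t) * ennreal \<delta>"] order_trans)
    \<comment> \<open>Cancellation among extended reals is legitimate because the sum of the
      \<open>G\<close> terms is finite.\<close>
    then show ?thesis using sG by (auto simp only: ennreal_add_left_cancel_le infinity_ennreal_def less_top)
  qed
  have "(\<Sum>t\<in>{n..<T}. ?q t * D t) \<le> 0"
  proof (rule ennreal_le_epsilon)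
    fix e :: real assume "0 < e"
    \<comment> \<open>The error is \<open>K * \<delta>\<close>; the choice
      \<open>\<delta> = e / (K + 1)\<close> keeps it below \<open>e\<close> without a case
      distinction on \<open>K = 0\<close>.\<close>
    define K where "K = (\<Sum>t\<in>{n..<T}. factor (Suc t))"
    have K: "0 \<le> K" unfolding K_def using factor_pos by (intro sum_nonneg) (simp add: less_imp_le)
    have "(\<Sum>t\<in>{n..<T}. ?q t) = ennreal K"
      unfolding K_def using factor_pos by (intro sum_ennreal) (simp add: less_imp_le)
    then have "(\<Sum>t\<in>{n..<T}. ?q t) * ennreal (e / (K + 1)) = ennreal (K * (e / (K + 1)))"
      using K \<open>0 < e\<close> by (simp add: ennreal_mult[symmetric])
    also have "\<dots> \<le> ennreal e"
      using K \<open>0 < e\<close> by (intro ennreal_leI) (simp add: field_simps)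
    finally show "(\<Sum>t\<in>{n..<T}. ?q t * D t) \<le> 0 + ennreal e"
      using key[of "e / (K + 1)"] K \<open>0 < e\<close> by (auto intro: order_trans)
  qed
  then have "?q r * D r = 0" using r by (simp add: sum_eq_0_iff)
  then have "D r = 0" using factor_pos[of "Suc r"] by (simp add: not_le)
  moreover have "(\<lambda>\<omega>. ennreal (extra_loss \<alpha> r (?W r \<omega>) (w r \<omega>)) * indicator (-{0}) (?W r \<omega>)) \<in> borel_measurable M"
    using mw[OF r(2)] measurable_wealth[OF w less_imp_le[OF r(2)]] unfolding extra_loss_def by measurable
  ultimately have "AE \<omega> in M. ennreal (extra_loss \<alpha> r (?W r \<omega>) (w r \<omega>)) * indicator (-{0}) (?W r \<omega>) = 0"
    unfolding D_def by (simp only: nn_integral_0_iff_AE)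
  then show ?thesis
  proof eventually_elim
    case (elim \<omega>)
    show ?case
    proof
      assume "?W r \<omega> \<noteq> 0"
      moreover from this elim have "extra_loss \<alpha> r (?W r \<omega>) (w r \<omega>) = 0"
        using extra_loss_nonneg[OF r(2)] by (simp add: ennreal_eq_0_iff antisym)
      ultimately show "w r \<omega> = optimal_weights \<alpha> \<mu> \<Sigma> T (r + 1) (?W r \<omega>)"
        using extra_loss_eq_0_iff[OF r(2)] by blast
    qed
  qed
qed

end

text \<open>The continuation from \<open>T - t\<close> comprises the decisions at
  \<open>T - s\<close> for \<open>s = 1, ..., t\<close>, each facing the return with index
  \<open>T - s + 1\<close>. There are two implications rather than an equivalence: sufficiency
  assumes wealth almost surely nonzero, necessity determines the weights wherever it is
  nonzero.\<close>

theorem corollary1: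
  fixes M :: "'a measure" and F :: "nat \<Rightarrow> 'a measure"
    and X :: "nat \<Rightarrow> 'a \<Rightarrow> real^'k" and w :: "nat \<Rightarrow> 'a \<Rightarrow> real^'k"
    and \<mu> :: "nat \<Rightarrow> real^'k" and \<Sigma> :: "nat \<Rightarrow> real^'k^'k"
    and T :: nat and \<alpha> W\<^sub>0 :: real
  assumes "independent_returns M F X \<mu> \<Sigma> T"
    and "\<alpha> > 0"
    and "trading_strategy M F T w"
  shows "\<forall>t\<in>{1..T}.
     (integrable M (\<lambda>\<omega>. (wealth W\<^sub>0 X w (T - t) \<omega>)\<^sup>2) \<and>
      (\<forall>s\<in>{1..t}. AE \<omega> in M. wealth W\<^sub>0 X w (T - s) \<omega> \<noteq> 0 \<and>
         w (T - s) \<omega> = optimal_weights \<alpha> \<mu> \<Sigma> T (T - s + 1) (wealth W\<^sub>0 X w (T - s) \<omega>))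
      \<longrightarrow> optimal_from M F X T \<alpha> W\<^sub>0 (T - t) w) \<and>
     (optimal_from M F X T \<alpha> W\<^sub>0 (T - t) w
      \<longrightarrow> (\<forall>s\<in>{1..t}. AE \<omega> in M. wealth W\<^sub>0 X w (T - s) \<omega> \<noteq> 0 \<longrightarrow>
         w (T - s) \<omega> = optimal_weights \<alpha> \<mu> \<Sigma> T (T - s + 1) (wealth W\<^sub>0 X w (T - s) \<omega>)))"
proof -
  interpret independent_returns M F X \<mu> \<Sigma> T by fact
  show ?thesis
  proof (intro ballI conjI impI)
    fix t
    assume h: "integrable M (\<lambda>\<omega>. (wealth W\<^sub>0 X w (T - t) \<omega>)\<^sup>2) \<and>
      (\<forall>s\<in>{1..t}. AE \<omega> in M. wealth W\<^sub>0 X w (T - s) \<omega> \<noteq> 0 \<and>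
         w (T - s) \<omega> = optimal_weights \<alpha> \<mu> \<Sigma> T (T - s + 1) (wealth W\<^sub>0 X w (T - s) \<omega>))"
    show "optimal_from M F X T \<alpha> W\<^sub>0 (T - t) w"
    proof (rule optimal_from_if_optimal_weights[OF assms(2,3)])
      fix r assume "T - t \<le> r" "r < T"
      \<comment> \<open>Reindexing by \<open>s = T - r\<close>; truncated subtraction is harmless as
        \<open>r < T\<close>.\<close>
      then have "T - r \<in> {1..t}" and r: "T - (T - r) = r" by auto
      with h have "AE \<omega> in M. wealth W\<^sub>0 X w (T - (T - r)) \<omega> \<noteq> 0 \<and>
        w (T - (T - r)) \<omega> = optimal_weights \<alpha> \<mu> \<Sigma> T (T - (T - r) + 1) (wealth W\<^sub>0 X w (T - (T - r)) \<omega>)"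
        by blast
      then show "AE \<omega> in M. wealth W\<^sub>0 X w r \<omega> \<noteq> 0 \<and>
        w r \<omega> = optimal_weights \<alpha> \<mu> \<Sigma> T (r + 1) (wealth W\<^sub>0 X w r \<omega>)"
        by (simp only: r)
    qed (use h in auto)
  next
    fix t s
    assume "t \<in> {1..T}" "optimal_from M F X T \<alpha> W\<^sub>0 (T - t) w" "s \<in> {1..t}"
    then show "AE \<omega> in M. wealth W\<^sub>0 X w (T - s) \<omega> \<noteq> 0 \<longrightarrow>
         w (T - s) \<omega> = optimal_weights \<alpha> \<mu> \<Sigma> T (T - s + 1) (wealth W\<^sub>0 X w (T - s) \<omega>)"
      by (intro optimal_weights_if_optimal_from[OF assms(2), of "T - t"]) auto
  qed
qed

end
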